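(* Let $\mathcal{F}_{st}$ be the family of configurations of graphs with two distinguished distinct nodes $s$ (source) and $t$ (sink) and a natural number capacity $c(e)$ on each edge $e$. For a positive integer $k$, let $k\text{-}\mathrm{MF}$ be the predicate over $\mathcal{F}_{st}$ which is true if and only if the maximum flow value between $s$ and $t$ is exactly $k$. Let $\alpha$ denote the arboricity and $\Delta$ the maximum degree of the underlying graph. Then for every $1\le r<2\alpha$ there exists a PLS for $(\mathcal{F}_{st},k\text{-}\mathrm{MF})$ in the $\mathrm{MCAST}(r)$ model with verification complexity $O\left(\frac{\min\{\alpha,k\}}{r}(\log k+\log\Delta)\right)$, and for every $2\alpha\le r\le\Delta$ there exists a PLS for $(\mathcal{F}_{st},k\text{-}\mathrm{MF})$ in the $\mathrm{MCAST}(r)$ model with verification complexity $O(\log k)$.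
   Context: A configuration $G_s$ consists of a finite connected undirected graph $G=(V,E)$ and a state for each node $v$; the state contains all local input, including a unique identifier, the capacities of incident edges (consistently at both endpoints; capacity $0$ is allowed), and whether $v$ is the source or the sink. The edges incident to $v$ are numbered by ports $1,\dots,d(v)$, where $d(v)$ is the degree of $v$. The value $k$ is known to all nodes. A flow is an assignment of integers $f(v,u)=-f(u,v)$ to edges with $|f(v,u)|\le c(v,u)$ and $\sum_u f(v,u)=0$ for $v\neq s,t$; its value is the net flow out of $s$. Let $\mathcal{F}$ be a family of configurations and $\mathcal{P}$ a boolean predicate on $\mathcal{F}$; $G_s$ is legal if $\mathcal{P}(G_s)$ is true. A proof-labeling scheme (PLS) for $(\mathcal{F},\mathcal{P})$ is a pair (prover, verifier). Given a legal $G_s$, the prover assigns each node $v$ a label (a bit string, of any length). The verifier is a distributed one-round algorithm: each node, as a function of its state and label, sends a message (bit string) on each port, then, as a function of its state, its label and the messages received on each of its ports, outputs True or False. A configuration with labels is accepted if all nodes output True, and otherwise rejected. Requirements: every legal $G_s$ with the prover's labels is accepted; every illegal $G_s\in\mathcal{F}$ is rejected for every label assignment. $\mathrm{MCAST}(r)$ model: each node partitions its neighbors into at most $r$ groups and sends the same message to all neighbors of a group (so at most $r$ distinct messages, an empty message counting as a message). The arboricity $\alpha(G)$ is the minimum number of acyclic edge subsets covering $E$. The verification complexity of a PLS is the maximal length of a message sent by the verifier under the prover's labels in legal configurations; the bounds are expressed in terms of the arboricity $\alpha$ and maximum degree $\Delta$ of the underlying graph, and of $r$ and $k$.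
   Formalization: Logarithms are read as at least 1, and the bound for r < 2α is the maximum of log k and the printed expression; the printed bound fails literally when k is much smaller than r (or k = 1), since Ω(log k), and at least one bit, is needed for every r. *)

theory Defs
  imports Complex_Main
begin

section \<open>Configurations\<close>

text \<open>
  The nodes are natural numbers, and a node's name is its unique identifier. Edges are two-element
  sets of nodes, so the graph is simple and a capacity is automatically the same at both
  endpoints. The entry \<open>ports G v ! i\<close> is the neighbor that \<open>v\<close> reaches through port \<open>i\<close>; ports
  are counted from 0.
\<close>

record config =
  verts :: "nat set"
  edges :: "nat set set"
  ports :: "nat \<Rightarrow> nat list"
  cap :: "nat set \<Rightarrow> nat"
  src :: nat
  snk :: nat

definition nbrs :: "config \<Rightarrow> nat \<Rightarrow> nat set" where
  "nbrs G v = {u. {v, u} \<in> edges G}"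

definition connected_graph :: "config \<Rightarrow> bool" where
  "connected_graph G \<longleftrightarrow>
     (\<forall>u\<in>verts G. \<forall>v\<in>verts G. (u, v) \<in> {(x, y). {x, y} \<in> edges G}\<^sup>*)"

definition F_st :: "config set" where
  "F_st = {G. finite (verts G)
            \<and> (\<forall>e\<in>edges G. e \<subseteq> verts G \<and> card e = 2)
            \<and> connected_graph G
            \<and> (\<forall>v\<in>verts G. distinct (ports G v) \<and> set (ports G v) = nbrs G v)
            \<and> src G \<in> verts G \<and> snk G \<in> verts G \<and> src G \<noteq> snk G}"

definition max_degree :: "config \<Rightarrow> nat" where
  "max_degree G = Max ((\<lambda>v. card (nbrs G v)) ` verts G)"

definition is_cycle :: "nat set set \<Rightarrow> nat list \<Rightarrow> bool" where
  "is_cycle A p \<longleftrightarrow> 3 \<le> length p \<and> distinct p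
     \<and> (\<forall>i<length p. {p ! i, p ! (Suc i mod length p)} \<in> A)"

definition acyclic_edges :: "nat set set \<Rightarrow> bool" where
  "acyclic_edges A \<longleftrightarrow> (\<nexists>p. is_cycle A p)"

definition arboricity :: "config \<Rightarrow> nat" where
  "arboricity G = (LEAST n. \<exists>A :: nat \<Rightarrow> nat set set.
     (\<forall>i<n. A i \<subseteq> edges G \<and> acyclic_edges (A i)) \<and> edges G = (\<Union>i<n. A i))"


section \<open>Flows\<close>

definition is_flow :: "config \<Rightarrow> (nat \<Rightarrow> nat \<Rightarrow> int) \<Rightarrow> bool" where
  "is_flow G f \<longleftrightarrow>
     (\<forall>v u. {v, u} \<in> edges G \<longrightarrow> f v u = - f u v \<and> \<bar>f v u\<bar> \<le> int (cap G {v, u}))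
   \<and> (\<forall>v\<in>verts G - {src G, snk G}. (\<Sum>u\<in>nbrs G v. f v u) = 0)"

definition flow_value :: "config \<Rightarrow> (nat \<Rightarrow> nat \<Rightarrow> int) \<Rightarrow> int" where
  "flow_value G f = (\<Sum>u\<in>nbrs G (src G). f (src G) u)"

definition MF :: "nat \<Rightarrow> config \<Rightarrow> bool" where
  "MF k G \<longleftrightarrow> (\<exists>f. is_flow G f \<and> flow_value G f = int k)
            \<and> (\<forall>f. is_flow G f \<longrightarrow> flow_value G f \<le> int k)"


section \<open>Proof-labeling schemes\<close>

type_synonym bits = "bool list"

datatype role = Source | Sink | Inner

text \<open>The degree of a node is the length of its list of port capacities.\<close>

record state =
  ident :: nat
  role :: role
  port_caps :: "nat list"

definition state_of :: "config \<Rightarrow> nat \<Rightarrow> state" where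
  "state_of G v = \<lparr> ident = v,
     role = (if v = src G then Source else if v = snk G then Sink else Inner),
     port_caps = map (\<lambda>u. cap G {v, u}) (ports G v) \<rparr>"

type_synonym prover = "config \<Rightarrow> nat \<Rightarrow> bits"

text \<open>
  From the state and the label, \<open>msg\<close> gives the message sent on each port; \<open>decide\<close> also gets the
  list of received messages, in port order.
\<close>

record verifier =
  msg :: "state \<Rightarrow> bits \<Rightarrow> nat \<Rightarrow> bits"
  decide :: "state \<Rightarrow> bits \<Rightarrow> bits list \<Rightarrow> bool"

definition port_to :: "config \<Rightarrow> nat \<Rightarrow> nat \<Rightarrow> nat" where
  "port_to G u v = (THE i. i < length (ports G u) \<and> ports G u ! i = v)"

definition received :: "verifier \<Rightarrow> config \<Rightarrow> (nat \<Rightarrow> bits) \<Rightarrow> nat \<Rightarrow> bits list" where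
  "received V G l v = map (\<lambda>u. msg V (state_of G u) (l u) (port_to G u v)) (ports G v)"

definition accepted :: "verifier \<Rightarrow> config \<Rightarrow> (nat \<Rightarrow> bits) \<Rightarrow> bool" where
  "accepted V G l \<longleftrightarrow>
     (\<forall>v\<in>verts G. decide V (state_of G v) (l v) (received V G l v))"

definition is_PLS :: "config set \<Rightarrow> (config \<Rightarrow> bool) \<Rightarrow> prover \<Rightarrow> verifier \<Rightarrow> bool" where
  "is_PLS \<F> \<P> P V \<longleftrightarrow>
     (\<forall>G\<in>\<F>. \<P> G \<longrightarrow> accepted V G (P G))
   \<and> (\<forall>G\<in>\<F>. \<not> \<P> G \<longrightarrow> (\<forall>l. \<not> accepted V G l))"

text \<open>
  In the following definition \<open>g\<close> is the partition of the ports into at most \<open>r\<close> groups and \<open>m\<close>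
  gives the message of each group. The partition may depend on the state and the label, and the
  restriction also binds nodes whose labels do not come from the prover.
\<close>

definition MCAST :: "nat \<Rightarrow> verifier \<Rightarrow> bool" where
  "MCAST r V \<longleftrightarrow> (\<forall>st l. \<exists>(g :: nat \<Rightarrow> nat) (m :: nat \<Rightarrow> bits).
     \<forall>i<length (port_caps st). g i < r \<and> msg V st l i = m (g i))"

text \<open>
  The maximal message length under the prover's labels in the single configuration \<open>G\<close>; the
  verification complexity of a scheme is a bound on this over all legal configurations, as a
  function of parameters of the configuration.
\<close>

definition max_msg_length :: "prover \<Rightarrow> verifier \<Rightarrow> config \<Rightarrow> nat" where
  "max_msg_length P V G =
     Max {length (msg V (state_of G v) (P G v) i) | v i. v \<in> verts G \<and> i < length (ports G v)}"

text \<open>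
  A logarithm inside an asymptotic bound is read as at least 1. Otherwise \<open>O(log k)\<close> would be zero
  bits for \<open>k = 1\<close>, and then nodes could not communicate at all.
\<close>

definition lg :: "nat \<Rightarrow> real" where
  "lg n = max 1 (log 2 (real n))"

text \<open>
  The bound for \<open>r < 2 * a\<close>, where \<open>a\<close> is the arboricity and \<open>d\<close> the maximum degree. The product
  tends to 0 when \<open>a\<close> and \<open>r\<close> grow together and \<open>k\<close> and \<open>log d / r\<close> stay small, whereas
  \<open>\<Omega>(lg k)\<close> bits are needed for every \<open>r\<close>. So it is read with the floor \<open>lg k\<close>, which is also
  the bound for \<open>r \<ge> 2 * a\<close>. The floor matters only if \<open>k < r\<close>: if \<open>r \<le> k\<close> and \<open>r < 2 * a\<close>,
  then \<open>min a k / r > 1 / 2\<close>, so the product exceeds \<open>lg k / 2\<close>.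
\<close>

definition small_r_bound :: "nat \<Rightarrow> nat \<Rightarrow> nat \<Rightarrow> nat \<Rightarrow> real" where
  "small_r_bound a d r k = max (lg k) (real (min a k) / real r * (lg k + lg d))"

end

theory Submission
  imports Defs "HOL-Library.Countable" "HOL-Library.Nat_Bijection"
    "HOL-Library.Transitive_Closure_Table"
begin

text \<open>The prover takes a maximum flow \<open>f\<close> of value \<open>k\<close> whose support is acyclic, and a minimum cut. A node
  knows the claimed flow on its edges from its label; the nodes check conservation, the value at the
  source, and saturation of the cut edges, for which one bit per message suffices. It remains to check
  that both ends of an edge claim opposite values. For this one end announces its value. Each node has
  to make at most \<open>m = min \<alpha> k\<close> announcements: the edges of \<open>\<alpha>\<close> forests have an orientation of out-degree
  at most \<open>\<alpha>\<close>, and an acyclic flow of value \<open>k\<close> leaves a node on at most \<open>k\<close> edges. If \<open>m < r\<close>, then each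
  announcement is a group of its own. Otherwise a group of neighbors gets a list of \<open>O(m / r)\<close>
  values, addressed by a colouring with \<open>\<Delta>\<^sup>2 + 1\<close> colours that is injective on every neighborhood.\<close>

section \<open>Orientations and colourings\<close>

text \<open>The first vertex of a longest path is a leaf: a second edge at it would either prolong
  the path or, ending on the path, close a cycle.\<close>

lemma acyclic_edges_leaf:
  assumes fin: "finite A" and ne: "A \<noteq> {}" and two: "\<And>e. e \<in> A \<Longrightarrow> card e = 2"
    and ac: "acyclic_edges A"
  obtains v w where "{v, w} \<in> A" "\<And>e. e \<in> A \<Longrightarrow> v \<in> e \<Longrightarrow> e = {v, w}"
proof -
  \<comment> \<open>Requiring two vertices gives the head \<open>v\<close> a successor
    \<open>w\<close> on the path.\<close>
  define P where "P p \<longleftrightarrow> 2 \<le> length p \<and> distinct p \<and>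
    (\<forall>i. Suc i < length p \<longrightarrow> {p ! i, p ! Suc i} \<in> A)" for p :: "nat list"
  have finU: "finite (\<Union>A)"
    using fin two by (metis card.infinite finite_Union zero_neq_numeral)
  have bound: "length p < Suc (card (\<Union>A))" if "P p" for p
  proof -
    have "x \<in> \<Union>A" if x: "x \<in> set p" for x
    proof -
      obtain i where i: "i < length p" "p ! i = x"
        using x by (auto simp: in_set_conv_nth)
      show ?thesis
      proof (cases "Suc i < length p")
        case True
        then have "{p ! i, p ! Suc i} \<in> A" using \<open>P p\<close> by (auto simp: P_def)
        then show ?thesis using i by blast
      next
        case False
        with i \<open>P p\<close> obtain j where j: "i = Suc j" by (cases i) (auto simp: P_def)
        then have "{p ! j, p ! Suc j} \<in> A" using \<open>P p\<close> i by (auto simp: P_def)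
        then show ?thesis using i j by blast
      qed
    qed
    then have "card (set p) \<le> card (\<Union>A)" by (intro card_mono finU) blast
    then show ?thesis using \<open>P p\<close> by (simp add: P_def distinct_card)
  qed
  obtain e0 where e0: "e0 \<in> A" using ne by blast
  then obtain x y where xy: "e0 = {x, y}" "x \<noteq> y" using two by (meson card_2_iff)
  have "P [x, y]" using xy e0 by (auto simp: P_def less_Suc_eq)
  then obtain p where p: "P p" and pmax: "\<And>q. P q \<Longrightarrow> length q \<le> length p"
    using ex_has_greatest_nat[of P "[x, y]" length "Suc (card (\<Union>A))"] bound by blast
  obtain v w ps where pw: "p = v # w # ps"
    using p by (cases p rule: remdups_adj.cases) (auto simp: P_def)
  have vw: "{v, w} \<in> A" using p by (force simp: P_def pw)
  have "e = {v, w}" if e: "e \<in> A" "v \<in> e" for e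
  proof (rule ccontr)
    assume "e \<noteq> {v, w}"
    then obtain y where y: "e = {v, y}" "y \<noteq> v" "y \<noteq> w"
      using two[OF e(1)] e(2) by (metis card_2_iff doubleton_eq_iff insertE singletonD)
    show False
    proof (cases "y \<in> set p")
      case False
      then have "P (y # p)"
        using p e y unfolding P_def pw
        by (auto simp: nth_Cons insert_commute split: nat.split)
      then show False using pmax[of "y # p"] by simp
    next
      case True
      then obtain j where j: "j < length p" "p ! j = y" by (auto simp: in_set_conv_nth)
      have "j \<noteq> 0" "j \<noteq> 1" using j(2) y by (auto simp: pw intro!: Nat.gr0I)
      then have j2: "2 \<le> j" by simp
      \<comment> \<open>Since \<open>y\<close> is neither \<open>v\<close> nor \<open>w\<close>, its
        position is at least 2, so this prefix has the three vertices that a cycle needs;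
        \<open>e\<close> is its closing edge.\<close>
      have "is_cycle A (take (Suc j) p)"
        unfolding is_cycle_def
      proof (intro conjI allI impI)
        show "3 \<le> length (take (Suc j) p)" using j j2 by simp
        show "distinct (take (Suc j) p)" using p by (simp add: P_def)
        fix i assume "i < length (take (Suc j) p)"
        then have i: "i \<le> j" using j by simp
        show "{take (Suc j) p ! i, take (Suc j) p ! (Suc i mod length (take (Suc j) p))} \<in> A"
        proof (cases "i = j")
          case True
          have "take (Suc j) p ! j = y" "take (Suc j) p ! 0 = v" using j by (simp_all, simp add: pw)
          then show ?thesis using True j e y by (simp add: insert_commute)
        next
          case False
          then show ?thesis using j i p by (simp add: P_def)
        qed
      qed
      then show False using ac by (auto simp: acyclic_edges_def)
    qed
  qed
  with vw that show thesis by blast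
qed

text \<open>An orientation of a forest with out-degree at most one. Remove a leaf edge, orient the
  rest, and let the leaf point along its edge; redirecting the leaf harms no other edge, as it has
  none.\<close>

lemma acyclic_edges_parent:
  assumes "finite A" and "\<And>e. e \<in> A \<Longrightarrow> card e = 2" and "acyclic_edges A"
  shows "\<exists>par :: nat \<Rightarrow> nat. \<forall>u v. {u, v} \<in> A \<longrightarrow> par u = v \<or> par v = u"
  using assms
proof (induction A rule: finite_psubset_induct)
  case (psubset A)
  show ?case
  proof (cases "A = {}")
    case False
    then obtain v w where vw: "{v, w} \<in> A" and leaf: "\<And>e. e \<in> A \<Longrightarrow> v \<in> e \<Longrightarrow> e = {v, w}"
      using acyclic_edges_leaf[OF psubset.hyps _ psubset.prems(1) psubset.prems(2)] by metis
    have "acyclic_edges (A - {{v, w}})"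
      using psubset.prems(2) by (auto simp: acyclic_edges_def is_cycle_def)
    then obtain par :: "nat \<Rightarrow> nat"
      where par: "\<And>u x. {u, x} \<in> A - {{v, w}} \<Longrightarrow> par u = x \<or> par x = u"
      using psubset.IH[of "A - {{v, w}}"] psubset.prems(1) vw by blast
    have "(par(v := w)) u = x \<or> (par(v := w)) x = u" if "{u, x} \<in> A" for u x
    proof (cases "v \<in> {u, x}")
      case True
      then show ?thesis using leaf[OF that] by (auto simp: doubleton_eq_iff)
    next
      case False
      then have "{u, x} \<in> A - {{v, w}}" using that by blast
      then show ?thesis using par False by auto
    qed
    then show ?thesis by blast
  qed simp
qed

text \<open>The \<open>LEAST\<close> in the definition is attained because the single edges already
  form a cover by acyclic sets.\<close>

lemma arboricity_cover:
  assumes fin: "finite (edges G)" and two: "\<And>e. e \<in> edges G \<Longrightarrow> card e = 2"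
  shows "\<exists>A :: nat \<Rightarrow> nat set set. (\<forall>i<arboricity G. A i \<subseteq> edges G \<and> acyclic_edges (A i))
    \<and> edges G = (\<Union>i<arboricity G. A i)"
  unfolding arboricity_def
proof (rule LeastI)
  obtain h where h: "bij_betw h {0..<card (edges G)} (edges G)"
    using ex_bij_betw_nat_finite[OF fin] by blast
  have single: "acyclic_edges {e}" if "card e = 2" for e :: "nat set"
    unfolding acyclic_edges_def
  proof
    assume "\<exists>p. is_cycle {e} p"
    then obtain p where len: "3 \<le> length p" and d: "distinct p"
      and c: "\<And>i. i < length p \<Longrightarrow> {p ! i, p ! (Suc i mod length p)} = e"
      by (auto simp: is_cycle_def)
    have "{p ! 0, p ! 1} = e"
      using c[of 0] len by (cases p) auto
    moreover have "{p ! 1, p ! 2} = e"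
      using c[of 1] len by (simp add: mod_less numeral_2_eq_2)
    ultimately have "{p ! 0, p ! 1} = {p ! 1, p ! 2}" by simp
    then have "p ! 0 = p ! 2" by (metis doubleton_eq_iff)
    moreover have "0 < length p" "2 < length p" using len by linarith+
    ultimately show False using d nth_eq_iff_index_eq[of p 0 2] by simp
  qed
  show "\<exists>A. (\<forall>i<card (edges G). A i \<subseteq> edges G \<and> acyclic_edges (A i))
    \<and> edges G = (\<Union>i<card (edges G). A i)"
  proof (intro exI[of _ "\<lambda>i. {h i}"] conjI allI impI)
    have im: "h ` {..<card (edges G)} = edges G"
      using bij_betw_imp_surj_on[OF h] by (simp add: atLeast0LessThan)
    then show "edges G = (\<Union>i<card (edges G). {h i})" by auto
    fix i assume "i < card (edges G)"
    then have "h i \<in> edges G" using im by blast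
    then show "{h i} \<subseteq> edges G" "acyclic_edges {h i}" using single two by auto
  qed
qed

text \<open>A node owns its parents in all the forests. Parent functions are total, so
  \<open>own v\<close> may also contain nodes that are not neighbors of \<open>v\<close>.\<close>

lemma arboricity_orientation:
  assumes fin: "finite (edges G)" and two: "\<And>e. e \<in> edges G \<Longrightarrow> card e = 2"
  obtains own :: "nat \<Rightarrow> nat set"
  where "\<And>v. finite (own v)" "\<And>v. card (own v) \<le> arboricity G"
    "\<And>u v. {u, v} \<in> edges G \<Longrightarrow> v \<in> own u \<or> u \<in> own v"
proof -
  obtain A :: "nat \<Rightarrow> nat set set"
    where A: "\<And>i. i < arboricity G \<Longrightarrow> A i \<subseteq> edges G \<and> acyclic_edges (A i)"
      and cover: "edges G = (\<Union>i<arboricity G. A i)"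
    using arboricity_cover[OF assms] by blast
  have "\<exists>par :: nat \<Rightarrow> nat. \<forall>u v. {u, v} \<in> A i \<longrightarrow> par u = v \<or> par v = u"
    if "i < arboricity G" for i
    using A[OF that] fin two by (intro acyclic_edges_parent) (auto intro: finite_subset)
  then obtain par :: "nat \<Rightarrow> nat \<Rightarrow> nat"
    where par: "\<And>i u v. i < arboricity G \<Longrightarrow> {u, v} \<in> A i \<Longrightarrow> par i u = v \<or> par i v = u"
    by metis
  show thesis
  proof (rule that[of "\<lambda>v. (\<lambda>i. par i v) ` {..<arboricity G}"])
    show "card ((\<lambda>i. par i v) ` {..<arboricity G}) \<le> arboricity G" for v
      by (rule card_image_le[THEN order_trans]) auto
    show "v \<in> (\<lambda>i. par i u) ` {..<arboricity G} \<or> u \<in> (\<lambda>i. par i v) ` {..<arboricity G}"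
      if "{u, v} \<in> edges G" for u v
      using that par unfolding cover by blast
  qed auto
qed

text \<open>Colour all vertices but \<open>x\<close> by induction; the at most \<open>D\<close>
  conflicting vertices leave one of \<open>D + 1\<close> colours free for \<open>x\<close>.\<close>

lemma greedy_colouring:
  fixes E :: "'a \<Rightarrow> 'a \<Rightarrow> bool"
  assumes "finite V" and "\<And>u w. E u w \<Longrightarrow> E w u"
    and "\<And>u. u \<in> V \<Longrightarrow> card {w \<in> V. w \<noteq> u \<and> E u w} \<le> D"
  shows "\<exists>c :: 'a \<Rightarrow> nat. \<forall>u\<in>V. c u \<le> D \<and> (\<forall>w\<in>V. w \<noteq> u \<longrightarrow> E u w \<longrightarrow> c u \<noteq> c w)"
  using assms(1,3)
proof (induction V)
  case (insert x V)
  have "card {w \<in> V. w \<noteq> u \<and> E u w} \<le> D" if "u \<in> V" for u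
  proof -
    have "card {w \<in> V. w \<noteq> u \<and> E u w} \<le> card {w \<in> insert x V. w \<noteq> u \<and> E u w}"
      using insert.hyps(1) by (intro card_mono) auto
    then show ?thesis using insert.prems[of u] that by simp
  qed
  then obtain c :: "'a \<Rightarrow> nat"
    where c: "\<And>u. u \<in> V \<Longrightarrow> c u \<le> D"
      "\<And>u w. u \<in> V \<Longrightarrow> w \<in> V \<Longrightarrow> w \<noteq> u \<Longrightarrow> E u w \<Longrightarrow> c u \<noteq> c w"
    using insert.IH by blast
  define N where "N = {w \<in> insert x V. w \<noteq> x \<and> E x w}"
  have "card (c ` N) \<le> D"
    using insert.prems[of x] insert.hyps(1) card_image_le[of N c] by (simp add: N_def)
  then have "\<not> {..D} \<subseteq> c ` N"
    using card_mono[of "c ` N" "{..D}"] insert.hyps(1) by (auto simp: N_def)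
  then obtain y where y: "y \<le> D" "y \<notin> c ` N" by auto
  show ?case
    using c y insert.hyps(2) assms(2)
    by (intro exI[of _ "c(x := y)"]) (auto simp: N_def)
qed simp

section \<open>Flows\<close>

text \<open>In contrast to \<^const>\<open>is_flow\<close>, flows vanish off the edges here, so that sums range over all
  vertices, and the balance at the sink is part of the definition.\<close>

definition st_flow :: "config \<Rightarrow> (nat \<Rightarrow> nat \<Rightarrow> int) \<Rightarrow> int \<Rightarrow> bool" where
  "st_flow G f x \<longleftrightarrow> (\<forall>v u. f v u = - f u v)
     \<and> (\<forall>v u. \<bar>f v u\<bar> \<le> (if {v, u} \<in> edges G then int (cap G {v, u}) else 0))
     \<and> (\<forall>v\<in>verts G. (\<Sum>u\<in>verts G. f v u) = x * (of_bool (v = src G) - of_bool (v = snk G)))"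

lemma st_flowD:
  assumes "st_flow G f x"
  shows "f v u = - f u v"
    and "\<bar>f v u\<bar> \<le> (if {v, u} \<in> edges G then int (cap G {v, u}) else 0)"
    and "v \<in> verts G \<Longrightarrow> (\<Sum>u\<in>verts G. f v u) = x * (of_bool (v = src G) - of_bool (v = snk G))"
  using assms unfolding st_flow_def by blast+

lemma F_st_edgeD:
  assumes "G \<in> F_st" "{u, v} \<in> edges G"
  shows "u \<in> verts G" "v \<in> verts G" "u \<noteq> v"
  using assms by (auto simp: F_st_def)

lemma finite_edges:
  assumes "G \<in> F_st"
  shows "finite (edges G)"
  using assms by (intro finite_subset[of "edges G" "Pow (verts G)"]) (auto simp: F_st_def)

lemma nbrs_subset_verts: "G \<in> F_st \<Longrightarrow> nbrs G v \<subseteq> verts G"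
  by (auto simp: nbrs_def dest: F_st_edgeD)

lemma finite_nbrs: "G \<in> F_st \<Longrightarrow> finite (nbrs G v)"
  by (rule finite_subset[OF nbrs_subset_verts]) (auto simp: F_st_def)

lemma sum_skew:
  fixes f :: "'a \<Rightarrow> 'a \<Rightarrow> int"
  assumes "\<And>v u. f v u = - f u v"
  shows "(\<Sum>v\<in>X. \<Sum>u\<in>X. f v u) = 0"
proof -
  have "(\<Sum>v\<in>X. \<Sum>u\<in>X. f v u) = (\<Sum>v\<in>X. \<Sum>u\<in>X. f u v)" by (rule sum.swap)
  also have "\<dots> = (\<Sum>v\<in>X. \<Sum>u\<in>X. - f v u)" by (intro sum.cong refl assms)
  also have "\<dots> = - (\<Sum>v\<in>X. \<Sum>u\<in>X. f v u)" by (simp add: sum_negf)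
  finally show ?thesis by linarith
qed

text \<open>Summing the balances over \<open>X\<close>, the flow inside \<open>X\<close> cancels by
  antisymmetry and only the flow across the cut remains.\<close>

lemma st_flow_cut:
  assumes G: "G \<in> F_st" and f: "st_flow G f x" and X: "X \<subseteq> verts G"
  shows "(\<Sum>v\<in>X. \<Sum>u\<in>verts G - X. f v u)
    = x * (of_bool (src G \<in> X) - of_bool (snk G \<in> X))"
proof -
  have fin: "finite (verts G)" "finite X" using G X by (auto simp: F_st_def intro: finite_subset)
  have "(\<Sum>v\<in>X. \<Sum>u\<in>verts G. f v u)
      = (\<Sum>v\<in>X. (\<Sum>u\<in>X. f v u) + (\<Sum>u\<in>verts G - X. f v u))"
    using fin X by (intro sum.cong refl) (simp add: sum.subset_diff add.commute)
  also have "\<dots> = (\<Sum>v\<in>X. \<Sum>u\<in>verts G - X. f v u)"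
    using sum_skew[of f X, OF st_flowD(1)[OF f]] by (simp add: sum.distrib)
  finally have "(\<Sum>v\<in>X. \<Sum>u\<in>verts G - X. f v u)
      = (\<Sum>v\<in>X. x * (of_bool (v = src G) - of_bool (v = snk G)))"
    using X by (simp add: st_flowD(3)[OF f] subset_iff)
  also have "\<dots> = x * ((\<Sum>v\<in>X. of_bool (v = src G)) - (\<Sum>v\<in>X. of_bool (v = snk G)))"
    by (simp only: sum_distrib_left[symmetric] sum_subtractf)
  also have "\<dots> = x * (of_bool (src G \<in> X) - of_bool (snk G \<in> X))"
    using fin by (simp add: of_bool_def sum.delta)
  finally show ?thesis .
qed

lemma st_flow_is_flow:
  assumes G: "G \<in> F_st" and f: "st_flow G f x"
  shows "is_flow G f" "flow_value G f = x"
proof -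
  have fin: "finite (verts G)" using G by (simp add: F_st_def)
  have zero: "f v u = 0" if "{v, u} \<notin> edges G" for v u
    using st_flowD(2)[OF f, of v u] that by simp
  have nb: "(\<Sum>u\<in>nbrs G v. f v u) = (\<Sum>u\<in>verts G. f v u)" for v
    using fin nbrs_subset_verts[OF G] zero by (intro sum.mono_neutral_left) (auto simp: nbrs_def)
  have "f v u = - f u v \<and> \<bar>f v u\<bar> \<le> int (cap G {v, u})" if "{v, u} \<in> edges G" for v u
    using st_flowD(1,2)[OF f, of v u] that by simp
  moreover have "(\<Sum>u\<in>nbrs G v. f v u) = 0" if "v \<in> verts G - {src G, snk G}" for v
    using st_flowD(3)[OF f, of v] that unfolding nb by simp
  ultimately show "is_flow G f" unfolding is_flow_def by blast
  show "flow_value G f = x"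
    using st_flowD(3)[OF f, of "src G"] G unfolding flow_value_def nb by (simp add: F_st_def)
qed

lemma is_flow_st_flow:
  assumes G: "G \<in> F_st" and f: "is_flow G f"
  shows "st_flow G (\<lambda>v u. if {v, u} \<in> edges G then f v u else 0) (flow_value G f)"
    (is "st_flow G ?f _")
proof -
  have fin: "finite (verts G)" using G by (simp add: F_st_def)
  have st: "src G \<in> verts G" "snk G \<in> verts G" "src G \<noteq> snk G" using G by (auto simp: F_st_def)
  have skew: "?f v u = - ?f u v" for v u
  proof (cases "{v, u} \<in> edges G")
    case True
    then have "f v u = - f u v" using f unfolding is_flow_def by blast
    then show ?thesis by (simp add: insert_commute)
  next
    case False
    then show ?thesis by (simp add: insert_commute)
  qed
  have nb: "(\<Sum>u\<in>verts G. ?f v u) = (\<Sum>u\<in>nbrs G v. f v u)" for v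
    using fin nbrs_subset_verts[OF G, of v]
    by (intro sum.mono_neutral_cong_right) (auto simp: nbrs_def)
  have s: "(\<Sum>u\<in>verts G. ?f (src G) u) = flow_value G f"
    unfolding nb flow_value_def ..
  have other: "(\<Sum>u\<in>verts G. ?f v u) = 0" if "v \<in> verts G" "v \<noteq> src G" "v \<noteq> snk G" for v
    unfolding nb using f that by (simp add: is_flow_def)
  \<comment> \<open>All balances add up to zero, so the sink absorbs exactly what the source emits,
    although \<open>is_flow\<close> says nothing about the sink.\<close>
  have "0 = (\<Sum>v\<in>verts G. \<Sum>u\<in>verts G. ?f v u)"
    by (rule sum_skew[symmetric]) (rule skew)
  also have "\<dots> = (\<Sum>v\<in>{src G, snk G}. \<Sum>u\<in>verts G. ?f v u)"
    using fin st other by (intro sum.mono_neutral_right) auto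
  finally have t: "(\<Sum>u\<in>verts G. ?f (snk G) u) = - flow_value G f"
    using st s by simp
  have c: "\<bar>?f v u\<bar> \<le> (if {v, u} \<in> edges G then int (cap G {v, u}) else 0)" for v u
  proof (cases "{v, u} \<in> edges G")
    case True
    then have "\<bar>f v u\<bar> \<le> int (cap G {v, u})" using f unfolding is_flow_def by blast
    with True show ?thesis by simp
  qed simp
  show ?thesis
    unfolding st_flow_def using st(3)
  proof (intro conjI allI ballI)
    fix v assume "v \<in> verts G"
    then show "(\<Sum>u\<in>verts G. ?f v u)
        = flow_value G f * (of_bool (v = src G) - of_bool (v = snk G))"
      using s t other[of v] st(3) by (cases "v = src G"; cases "v = snk G") (simp_all cong: if_cong)
  qed (rule skew c)+
qed

section \<open>Unit flows along paths, saturated cuts and acyclic flows\<close>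

text \<open>A unit flow from \<open>x\<close> to \<open>y\<close> along arcs of \<open>R\<close>.
  Quantifying over \<open>W\<close> states the balance without fixing a vertex set, so the same
  notion serves for residual arcs and for arcs of positive flow.\<close>

definition path_flow :: "('a \<Rightarrow> 'a \<Rightarrow> bool) \<Rightarrow> 'a \<Rightarrow> 'a \<Rightarrow> ('a \<Rightarrow> 'a \<Rightarrow> int) \<Rightarrow> bool" where
  "path_flow R x y g \<longleftrightarrow> (\<forall>a b. g a b = - g b a)
     \<and> (\<forall>a b. g a b > 0 \<longrightarrow> g a b = 1 \<and> R a b)
     \<and> (\<forall>W v. finite W \<longrightarrow> (\<forall>a b. R a b \<longrightarrow> a \<in> W \<and> b \<in> W) \<longrightarrow> v \<in> W \<longrightarrow>
           (\<Sum>u\<in>W. g v u) = of_bool (v = x) - of_bool (v = y))"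

lemma path_flowD:
  assumes "path_flow R x y g"
  shows "g a b = - g b a" and "g a b > 0 \<Longrightarrow> g a b = 1 \<and> R a b"
    and "finite W \<Longrightarrow> (\<And>a b. R a b \<Longrightarrow> a \<in> W \<and> b \<in> W) \<Longrightarrow> v \<in> W \<Longrightarrow>
      (\<Sum>u\<in>W. g v u) = of_bool (v = x) - of_bool (v = y)"
  using assms unfolding path_flow_def by blast+

lemma path_flow_exists:
  assumes "(x, y) \<in> {(a, b). R a b}\<^sup>*"
  shows "\<exists>g. path_flow R x y g"
proof -
  have "R\<^sup>*\<^sup>* x y" using assms by (simp add: rtranclp_rtrancl_eq)
  then obtain xs where "rtrancl_path R x xs y" by (auto simp: rtranclp_eq_rtrancl_path)
  then obtain xs where "rtrancl_path R x xs y" "distinct (x # xs)"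
    by (rule rtrancl_path_distinct)
  \<comment> \<open>The support is tracked in the induction: on a simple path the flow of the tail
    vanishes at the new first vertex, so the added arc never accumulates with it.\<close>
  then have "\<exists>g. path_flow R x y g \<and> (\<forall>a b. g a b \<noteq> 0 \<longrightarrow> a \<in> set (x # xs))"
  proof (induction rule: rtrancl_path.induct)
    case (base x)
    show ?case by (intro exI[of _ "\<lambda>a b. 0"]) (simp add: path_flow_def)
  next
    case (step x z xs y)
    then obtain g where g: "path_flow R z y g"
      and supp: "\<And>a b. g a b \<noteq> 0 \<Longrightarrow> a \<in> set (z # xs)"
      by (metis distinct.simps(2))
    have xz: "x \<noteq> z" "x \<notin> set (z # xs)" using step.prems by auto
    have zero1: "g x b = 0" for b using supp[of x b] xz(2) by blast
    have zero2: "g b x = 0" for b using path_flowD(1)[OF g, of b x] zero1 by simp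
    define h :: "'a \<Rightarrow> 'a \<Rightarrow> int"
      where "h a b = g a b + (of_bool (a = x \<and> b = z) - of_bool (a = z \<and> b = x))" for a b
    have "path_flow R x y h"
      unfolding path_flow_def
    proof (intro conjI allI impI)
      show "h a b = - h b a" for a b
        using path_flowD(1)[OF g, of a b] by (simp add: h_def conj_commute)
      show "h a b = 1" if "h a b > 0" for a b
        using that path_flowD(2)[OF g, of a b] zero1 zero2 xz(1)
        by (auto simp: h_def of_bool_def split: if_splits)
      show "R a b" if "h a b > 0" for a b
        using that path_flowD(2)[OF g, of a b] zero1 zero2 xz(1) step.hyps
        by (auto simp: h_def of_bool_def split: if_splits)
      fix W v assume W: "finite W" "\<forall>a b. R a b \<longrightarrow> a \<in> W \<and> b \<in> W" "v \<in> W"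
      have "x \<in> W" "z \<in> W" using W(2) step.hyps by auto
      then have "(\<Sum>u\<in>W. of_bool (v = x \<and> u = z) - of_bool (v = z \<and> u = x))
          = (of_bool (v = x) - of_bool (v = z) :: int)"
        using W(1) xz(1)
        by (cases "v = x"; cases "v = z") (auto simp: of_bool_def sum_negf sum.delta)
      then show "(\<Sum>u\<in>W. h v u) = of_bool (v = x) - of_bool (v = y)"
        using path_flowD(3)[OF g W(1) _ W(3)] W(2) by (simp add: h_def sum.distrib)
    qed
    moreover have "a \<in> set (x # z # xs)" if "h a b \<noteq> 0" for a b
      using that supp[of a b] by (auto simp: h_def of_bool_def split: if_splits)
    ultimately show ?case by (intro exI[of _ h]) blast
  qed
  then show ?thesis by blast
qed

text \<open>\<open>S\<close> is the set of nodes reachable from the source by residual arcs. No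
  residual arc leaves it, and by integrality a residual path to the sink would carry one more
  unit.\<close>

lemma max_flow_saturated_cut:
  assumes G: "G \<in> F_st" and f: "st_flow G f x"
    and mx: "\<forall>g y. st_flow G g y \<longrightarrow> y \<le> x"
  shows "\<exists>S. src G \<in> S \<and> snk G \<notin> S
    \<and> (\<forall>v u. {v, u} \<in> edges G \<longrightarrow> v \<in> S \<longrightarrow> u \<notin> S \<longrightarrow> f v u = int (cap G {v, u}))"
proof -
  define R where "R v u \<longleftrightarrow> {v, u} \<in> edges G \<and> f v u < int (cap G {v, u})" for v u
  define S where "S = {v. (src G, v) \<in> {(a, b). R a b}\<^sup>*}"
  have fin: "finite (verts G)" using G by (simp add: F_st_def)
  have "snk G \<notin> S"
  proof
    assume "snk G \<in> S"
    then have "(src G, snk G) \<in> {(a, b). R a b}\<^sup>*" by (simp add: S_def)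
    from path_flow_exists[OF this] obtain g where g: "path_flow R (src G) (snk G) g" ..
    note skew = path_flowD(1)[OF g] and pos = path_flowD(2)[OF g] and dv = path_flowD(3)[OF g]
    have dv': "(\<Sum>u\<in>verts G. g v u) = of_bool (v = src G) - of_bool (v = snk G)"
      if "v \<in> verts G" for v
      using fin that by (intro dv) (auto simp: R_def dest: F_st_edgeD[OF G])
    have c: "\<bar>f v u\<bar> \<le> (if {v, u} \<in> edges G then int (cap G {v, u}) else 0)"
      and fskew: "f v u = - f u v" for v u
      using st_flowD(1,2)[OF f] by blast+
    have "st_flow G (\<lambda>v u. f v u + g v u) (x + 1)"
      unfolding st_flow_def
    proof (intro conjI allI ballI)
      fix v u
      show "f v u + g v u = - (f u v + g u v)"
        using skew[of v u] fskew[of v u] by simp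
      show "\<bar>f v u + g v u\<bar> \<le> (if {v, u} \<in> edges G then int (cap G {v, u}) else 0)"
      proof -
        \<comment> \<open>In the last case the slack of the reverse arc keeps the value above the
          negated capacity.\<close>
        consider "g v u = 0" | "g v u = 1" "R v u" | "g v u = -1" "R u v"
          using pos[of v u] pos[of u v] skew[of v u] by linarith
        then show ?thesis
          using c[of v u] fskew[of v u] by cases (auto simp: R_def insert_commute)
      qed
    next
      fix v assume "v \<in> verts G"
      then show "(\<Sum>u\<in>verts G. f v u + g v u)
          = (x + 1) * (of_bool (v = src G) - of_bool (v = snk G))"
        using st_flowD(3)[OF f, of v] dv'[of v] by (simp add: sum.distrib algebra_simps)
    qed
    then show False using mx by fastforce
  qed
  moreover have "src G \<in> S" by (simp add: S_def)
  moreover have "f v u = int (cap G {v, u})" if e: "{v, u} \<in> edges G" "v \<in> S" "u \<notin> S" for v u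
  proof -
    have "\<not> R v u" using e(2,3) unfolding S_def by (auto dest: rtrancl_into_rtrancl)
    moreover have "\<bar>f v u\<bar> \<le> int (cap G {v, u})" using st_flowD(2)[OF f, of v u] e(1) by simp
    ultimately show ?thesis using e(1) by (auto simp: R_def)
  qed
  ultimately show ?thesis by blast
qed

text \<open>Cancelling a cycle of positive flow lowers the total absolute value, so a flow that minimises it
  is acyclic.\<close>

lemma acyclic_flow_exists:
  assumes G: "G \<in> F_st" and f0: "st_flow G f0 x"
  obtains f where "st_flow G f x"
    "\<And>u v. f u v > 0 \<Longrightarrow> (v, u) \<notin> {(a, b). f a b > 0}\<^sup>*"
proof -
  define w where "w f = (\<Sum>v\<in>verts G. \<Sum>u\<in>verts G. nat \<bar>f v u :: int\<bar>)" for f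
  have fin: "finite (verts G)" using G by (simp add: F_st_def)
  obtain f where f: "st_flow G f x" and least: "\<And>g. st_flow G g x \<Longrightarrow> w f \<le> w g"
    using exists_least_iff[of "\<lambda>n. \<exists>g. st_flow G g x \<and> w g = n"] f0 by (metis not_le)
  have c: "\<bar>f v u\<bar> \<le> (if {v, u} \<in> edges G then int (cap G {v, u}) else 0)"
    and fskew: "f v u = - f u v" for v u
    using st_flowD(1,2)[OF f] by blast+
  have inV: "a \<in> verts G" "b \<in> verts G" "a \<noteq> b" if "f a b > 0" for a b
    using c[of a b] that F_st_edgeD[OF G, of a b] by (auto split: if_splits)
  have "(v, u) \<notin> {(a, b). f a b > 0}\<^sup>*" if uv: "f u v > 0" for u v
  proof
    assume path: "(v, u) \<in> {(a, b). f a b > 0}\<^sup>*"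
    \<comment> \<open>The return path must avoid the arc \<open>(u, v)\<close>, so that adding this
      arc to it yields a circulation with entries -1, 0 and 1. A walk from \<open>v\<close> that
      crosses \<open>(u, v)\<close> is back at \<open>v\<close> and can start afresh.\<close>
    define R where "R a b \<longleftrightarrow> f a b > 0 \<and> (a, b) \<noteq> (u, v)" for a b
    have "(v, y) \<in> {(a, b). R a b}\<^sup>*" if "(v, y) \<in> {(a, b). f a b > 0}\<^sup>*" for y
      using that
    proof (induction rule: rtrancl_induct)
      case (step y z)
      then show ?case
        by (cases "(y, z) = (u, v)") (auto simp: R_def intro: rtrancl_into_rtrancl)
    qed simp
    with path have "(v, u) \<in> {(a, b). R a b}\<^sup>*" by blast
    from path_flow_exists[OF this] obtain g where g: "path_flow R v u g" ..
    note skew = path_flowD(1)[OF g] and pos = path_flowD(2)[OF g] and dv = path_flowD(3)[OF g]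
    have dv': "(\<Sum>z\<in>verts G. g y z) = of_bool (y = v) - of_bool (y = u)"
      if "y \<in> verts G" for y
      using fin that by (intro dv) (auto simp: R_def dest: inV)
    have "u \<noteq> v" using inV[OF uv] by simp
    have guv: "g u v = 0"
      using pos[of u v] pos[of v u] skew[of u v] uv fskew[of u v] by (force simp: R_def)
    define h :: "nat \<Rightarrow> nat \<Rightarrow> int"
      where "h a b = g a b + (of_bool (a = u \<and> b = v) - of_bool (a = v \<and> b = u))" for a b
    have hskew: "h a b = - h b a" for a b using skew[of a b] by (simp add: h_def conj_commute)
    have hpos: "h a b = 1 \<and> f a b > 0" if "h a b > 0" for a b
      using that pos[of a b] guv uv skew[of u v] \<open>u \<noteq> v\<close>
      by (auto simp: h_def of_bool_def R_def split: if_splits)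
    have hdv: "(\<Sum>z\<in>verts G. h y z) = 0" if y: "y \<in> verts G" for y
    proof -
      have "(\<Sum>z\<in>verts G. of_bool (y = u \<and> z = v) - of_bool (y = v \<and> z = u))
          = (of_bool (y = u) - of_bool (y = v) :: int)"
        using fin inV[OF uv]
        by (cases "y = u"; cases "y = v") (auto simp: of_bool_def sum_negf sum.delta)
      then show ?thesis using dv'[OF y] by (simp add: h_def sum.distrib)
    qed
    define f' where "f' a b = f a b - h a b" for a b
    \<comment> \<open>The circulation \<open>h\<close> runs only along positive flow, where integer
      values are at least 1, so subtracting it moves every value towards 0.\<close>
    have le: "\<bar>f' a b\<bar> \<le> \<bar>f a b\<bar>" for a b
      using hpos[of a b] hpos[of b a] hskew[of a b] fskew[of a b]
      unfolding f'_def by linarith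
    have lt: "\<bar>f' u v\<bar> < \<bar>f u v\<bar>"
      using guv \<open>u \<noteq> v\<close> uv by (auto simp: f'_def h_def)
    have "st_flow G f' x"
      unfolding st_flow_def
    proof (intro conjI allI ballI)
      show "f' a b = - f' b a" for a b
        using hskew[of a b] fskew[of a b] by (simp add: f'_def)
      show "\<bar>f' a b\<bar> \<le> (if {a, b} \<in> edges G then int (cap G {a, b}) else 0)" for a b
        using le[of a b] c[of a b] by (rule order_trans)
      show "(\<Sum>b\<in>verts G. f' a b) = x * (of_bool (a = src G) - of_bool (a = snk G))"
        if "a \<in> verts G" for a
        using st_flowD(3)[OF f that] hdv[OF that] by (simp add: f'_def sum_subtractf)
    qed
    moreover have "w f' < w f"
      unfolding w_def
    proof (rule sum_strict_mono_ex1[OF fin])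
      show "\<forall>a\<in>verts G. (\<Sum>b\<in>verts G. nat \<bar>f' a b\<bar>) \<le> (\<Sum>b\<in>verts G. nat \<bar>f a b\<bar>)"
        using le by (auto intro!: sum_mono nat_mono)
      have "(\<Sum>b\<in>verts G. nat \<bar>f' u b\<bar>) < (\<Sum>b\<in>verts G. nat \<bar>f u b\<bar>)"
        using le lt inV[OF uv]
        by (intro sum_strict_mono_ex1[OF fin]) (auto intro!: nat_mono bexI[of _ v])
      then show "\<exists>a\<in>verts G. (\<Sum>b\<in>verts G. nat \<bar>f' a b\<bar>) < (\<Sum>b\<in>verts G. nat \<bar>f a b\<bar>)"
        using inV[OF uv] by blast
    qed
    ultimately show False using least by fastforce
  qed
  with f that show thesis by blast
qed

text \<open>Let \<open>Y\<close> be the nodes from which \<open>v\<close> is reachable along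
  positive flow. No flow enters \<open>Y\<close>, and by acyclicity everything that \<open>v\<close>
  sends leaves \<open>Y\<close>. Hence the outflow of \<open>v\<close> is at most the net flow out
  of \<open>Y\<close>, which is at most \<open>k\<close>.\<close>

lemma acyclic_flow_outflow:
  assumes G: "G \<in> F_st" and f: "st_flow G f (int k)"
    and ac: "\<forall>u v. f u v > 0 \<longrightarrow> (v, u) \<notin> {(a, b). f a b > 0}\<^sup>*"
    and v: "v \<in> verts G"
  shows "(\<Sum>u | f v u > 0. f v u) \<le> int k" "finite {u. f v u > 0}"
proof -
  have fin: "finite (verts G)" using G by (simp add: F_st_def)
  have c: "\<bar>f v u\<bar> \<le> (if {v, u} \<in> edges G then int (cap G {v, u}) else 0)"
    and fskew: "f v u = - f u v" for v u
    using st_flowD(1,2)[OF f] by blast+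
  have inV: "a \<in> verts G" "b \<in> verts G" if "f a b > 0" for a b
    using c[of a b] that F_st_edgeD[OF G, of a b] by (auto split: if_splits)
  show "finite {u. f v u > 0}" using inV(2) fin by (auto intro: finite_subset)
  define Y where "Y = {y \<in> verts G. (y, v) \<in> {(a, b). f a b > 0}\<^sup>*}"
  have nonneg: "f y u \<ge> 0" if "y \<in> Y" "u \<in> verts G - Y" for y u
  proof (rule ccontr)
    assume "\<not> f y u \<ge> 0"
    then have "f u y > 0" using fskew[of u y] by simp
    then have "(u, v) \<in> {(a, b). f a b > 0}\<^sup>*"
      using that(1) by (auto simp: Y_def intro: converse_rtrancl_into_rtrancl)
    then show False using that(2) by (simp add: Y_def)
  qed
  have "(\<Sum>u | f v u > 0. f v u) \<le> (\<Sum>u\<in>verts G - Y. f v u)"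
    using fin v nonneg ac inV(2) by (intro sum_mono2) (auto simp: Y_def)
  also have "\<dots> = (\<Sum>y\<in>{v}. \<Sum>u\<in>verts G - Y. f y u)" by simp
  also have "\<dots> \<le> (\<Sum>y\<in>Y. \<Sum>u\<in>verts G - Y. f y u)"
    using fin v nonneg by (intro sum_mono2) (auto simp: Y_def intro!: sum_nonneg)
  also have "\<dots> = int k * (of_bool (src G \<in> Y) - of_bool (snk G \<in> Y))"
    by (rule st_flow_cut[OF G f]) (auto simp: Y_def)
  also have "\<dots> \<le> int k" by (simp add: of_bool_def)
  finally show "(\<Sum>u | f v u > 0. f v u) \<le> int k" .
qed

text \<open>Here \<open>own v\<close> are the neighbors to which \<open>v\<close> announces the flow: those along outgoing flow edges if
  \<open>k\<close> is the minimum, and the out-neighbors in an orientation of the forests otherwise.\<close>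

lemma flow_with_owners:
  assumes G: "G \<in> F_st" and mf: "MF k G"
  obtains f :: "nat \<Rightarrow> nat \<Rightarrow> int" and own S where "st_flow G f (int k)"
    "src G \<in> S" "snk G \<notin> S"
    "\<And>v u. {v, u} \<in> edges G \<Longrightarrow> v \<in> S \<Longrightarrow> u \<notin> S \<Longrightarrow> f v u = int (cap G {v, u})"
    "\<And>v u. \<bar>f v u\<bar> \<le> int k"
    "\<And>v. v \<in> verts G \<Longrightarrow> finite (own v) \<and> card (own v) \<le> min (arboricity G) k"
    "\<And>v u. {v, u} \<in> edges G \<Longrightarrow> u \<in> own v \<or> v \<in> own u \<or> f v u = 0"
proof -
  obtain f0 where f0: "is_flow G f0" "flow_value G f0 = int k" using mf by (auto simp: MF_def)
  obtain f where f: "st_flow G f (int k)"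
    and ac: "\<forall>u v. f u v > 0 \<longrightarrow> (v, u) \<notin> {(a, b). f a b > 0}\<^sup>*"
    using acyclic_flow_exists[OF G is_flow_st_flow[OF G f0(1), unfolded f0(2)]] by auto
  have c: "\<bar>f v u\<bar> \<le> (if {v, u} \<in> edges G then int (cap G {v, u}) else 0)"
    and fskew: "f v u = - f u v" for v u
    using st_flowD(1,2)[OF f] by blast+
  have inV: "a \<in> verts G" "b \<in> verts G" if "f a b > 0" for a b
    using c[of a b] that F_st_edgeD[OF G, of a b] by (auto split: if_splits)
  have le: "\<forall>g y. st_flow G g y \<longrightarrow> y \<le> int k"
  proof (intro allI impI)
    fix g y assume "st_flow G g y"
    then show "y \<le> int k"
      using mf st_flow_is_flow[OF G] unfolding MF_def by blast
  qed
  obtain S where S: "src G \<in> S" "snk G \<notin> S"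
    "\<And>v u. {v, u} \<in> edges G \<Longrightarrow> v \<in> S \<Longrightarrow> u \<notin> S \<Longrightarrow> f v u = int (cap G {v, u})"
    using max_flow_saturated_cut[OF G f le] by auto
  note out = acyclic_flow_outflow[OF G f ac]
  have pos: "f v u \<le> int k" for v u
  proof (cases "f v u > 0")
    case True
    have "f v u \<le> (\<Sum>u | f v u > 0. f v u)"
      using True out(2)[OF inV(1)[OF True]] by (intro member_le_sum) auto
    then show ?thesis using out(1)[OF inV(1)[OF True]] by linarith
  qed auto
  have absk: "\<bar>f v u\<bar> \<le> int k" for v u
    using pos[of v u] pos[of u v] fskew[of u v] by linarith
  \<comment> \<open>Each positive value contributes at least 1 to the outflow.\<close>
  have cardk: "card {u. f v u > 0} \<le> k" if "v \<in> verts G" for v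
  proof -
    have "int (card {u. f v u > 0}) = (\<Sum>u | f v u > 0. 1)" by simp
    also have "\<dots> \<le> (\<Sum>u | f v u > 0. f v u)" by (intro sum_mono) auto
    finally show ?thesis using out(1)[OF that] by linarith
  qed
  obtain own where own: "\<And>v. finite (own v)" "\<And>v. card (own v) \<le> arboricity G"
    "\<And>u v. {u, v} \<in> edges G \<Longrightarrow> v \<in> own u \<or> u \<in> own v"
    using arboricity_orientation[OF finite_edges[OF G]] G by (auto simp: F_st_def)
  show thesis
  proof (cases "arboricity G \<le> k")
    case True
    show thesis
      using own True by (intro that[OF f S absk, of own]) auto
  next
    case False
    show thesis
    proof (intro that[OF f S absk, of "\<lambda>v. {u. f v u > 0}"])
      show "finite {u. 0 < f v u} \<and> card {u. 0 < f v u} \<le> min (arboricity G) k"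
        if "v \<in> verts G" for v
        using out(2)[OF that] cardk[OF that] False by simp
      \<comment> \<open>By antisymmetry a nonzero flow is positive at exactly one end, which
        announces it.\<close>
      show "u \<in> {u. 0 < f v u} \<or> v \<in> {v. 0 < f u v} \<or> f v u = 0" for v u
        using fskew[of v u] by auto
    qed auto
  qed
qed

section \<open>Encoding messages\<close>

text \<open>A self-delimiting binary code: every digit is preceded by the bit \<open>True\<close>.\<close>

fun nat_bits :: "nat \<Rightarrow> bits" where
  "nat_bits n = (if n = 0 then [False] else True # odd n # nat_bits (n div 2))"

declare nat_bits.simps [simp del]

lemma nat_bits_0 [simp]: "nat_bits 0 = [False]"
  by (simp add: nat_bits.simps)

text \<open>The code is prefix-free, so a concatenation of codes splits uniquely.\<close>

lemma nat_bits_append_inject: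
  "nat_bits a @ x = nat_bits b @ y \<Longrightarrow> a = b \<and> x = y"
proof (induction a arbitrary: b rule: nat_bits.induct)
  case (1 a)
  show ?case
  proof (cases "a = 0 \<or> b = 0")
    case True
    then show ?thesis
      using "1.prems" nat_bits.simps[of a] nat_bits.simps[of b] by (auto split: if_splits)
  next
    case False
    then have "odd a = odd b" "nat_bits (a div 2) @ x = nat_bits (b div 2) @ y"
      using "1.prems" nat_bits.simps[of a] nat_bits.simps[of b] by auto
    moreover from this have "a div 2 = b div 2 \<and> x = y"
      using "1.IH" False by blast
    ultimately show ?thesis by (metis odd_two_times_div_two_succ even_two_times_div_two)
  qed
qed

section \<open>Logarithms and code lengths\<close>

lemma lg_ge_1: "1 \<le> lg n"
  by (simp add: lg_def)

lemma lg_mult: "lg (a * b) \<le> lg a + lg b"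
proof (cases "a = 0 \<or> b = 0")
  case True
  then have "lg (a * b) = 1" by (auto simp: lg_def log_def)
  then show ?thesis using lg_ge_1[of a] lg_ge_1[of b] by linarith
next
  case False
  then show ?thesis by (auto simp: lg_def log_mult)
qed

lemma lg_mono:
  assumes "a \<le> b"
  shows "lg a \<le> lg b"
proof (cases "a = 0")
  case True
  then have "lg a = 1" by (simp add: lg_def log_def)
  then show ?thesis using lg_ge_1[of b] by simp
next
  case False
  then have "log 2 (real a) \<le> log 2 (real b)" using assms by simp
  then show ?thesis by (auto simp: lg_def)
qed

text \<open>Two bits for each of the at most \<open>log 2 n + 1\<close> binary digits and one
  closing bit.\<close>

lemma length_nat_bits: "n > 0 \<Longrightarrow> real (length (nat_bits n)) \<le> 2 * log 2 (real n) + 3"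
proof (induction n rule: nat_bits.induct)
  case (1 n)
  show ?case
  proof (cases "n = 1")
    case True
    then show ?thesis by (simp add: nat_bits.simps[of "Suc 0"])
  next
    case False
    then have n: "n div 2 > 0" "n \<noteq> 0" using "1.prems" by auto
    have "real (2 * (n div 2)) \<le> real n" by linarith
    then have "log 2 (2 * real (n div 2)) \<le> log 2 (real n)" using n by simp
    then have "1 + log 2 (real (n div 2)) \<le> log 2 (real n)" using n by (simp add: log_mult)
    moreover have "real (length (nat_bits n)) = 2 + real (length (nat_bits (n div 2)))"
      using n by (subst nat_bits.simps) simp
    ultimately show ?thesis using "1.IH"[OF n(2) n(1)] by linarith
  qed
qed

lemma length_nat_bits_le: "real (length (nat_bits n)) \<le> 5 * lg n"
proof (cases "n = 0")
  case True
  then show ?thesis using lg_ge_1[of n] by simp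
next
  case False
  \<comment> \<open>The constant 5 is 2 + 3, the additive 3 being absorbed because
    \<open>lg n\<close> is at least 1.\<close>
  have "log 2 (real n) \<le> lg n" by (simp add: lg_def)
  then show ?thesis using length_nat_bits[of n] False lg_ge_1[of n] by simp
qed

fun enc_nats :: "nat list \<Rightarrow> bits" where
  "enc_nats [] = []" |
  "enc_nats (n # ns) = nat_bits n @ enc_nats ns"

lemma nat_bits_neq_Nil: "nat_bits n \<noteq> []"
  by (subst nat_bits.simps) auto

lemma inj_enc_nats: "enc_nats xs = enc_nats ys \<Longrightarrow> xs = ys"
proof (induction xs arbitrary: ys)
  case Nil
  then show ?case by (cases ys) (auto simp: nat_bits_neq_Nil)
next
  case (Cons x xs)
  show ?case
  proof (cases ys)
    case Nil
    then show ?thesis using Cons.prems by (simp add: nat_bits_neq_Nil)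
  next
    case (Cons y ys')
    then show ?thesis
      using Cons.prems Cons.IH[of ys'] nat_bits_append_inject[of x "enc_nats xs" y "enc_nats ys'"]
      by auto
  qed
qed

text \<open>A message holds the sender's side of the cut, the sender's colour, and flow values addressed
  by the colours of the receivers.\<close>

type_synonym entries = "(nat \<times> int) list"

fun flatten_entries :: "entries \<Rightarrow> nat list" where
  "flatten_entries [] = []" |
  "flatten_entries ((c, x) # es) = c # int_encode x # flatten_entries es"

fun enc_msg :: "bool \<times> nat \<times> entries \<Rightarrow> bits" where
  "enc_msg (b, c, es) = enc_nats (of_bool b # c # flatten_entries es)"

declare enc_msg.simps [simp del]

lemma inj_flatten_entries: "flatten_entries xs = flatten_entries ys \<Longrightarrow> xs = ys"
proof (induction xs arbitrary: ys rule: flatten_entries.induct)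
  case 1
  then show ?case by (cases ys rule: flatten_entries.cases) auto
next
  case (2 c x es)
  then show ?case
    by (cases ys rule: flatten_entries.cases) (auto simp: inj_int_encode[THEN inj_eq])
qed

lemma inj_enc_msg: "inj enc_msg"
proof (rule injI)
  fix x y :: "bool \<times> nat \<times> entries"
  assume "enc_msg x = enc_msg y"
  then show "x = y"
    by (cases x; cases y)
      (auto dest!: inj_enc_nats inj_flatten_entries simp del: enc_nats.simps
        simp: enc_msg.simps of_bool_def split: if_splits)
qed

definition dec_msg :: "bits \<Rightarrow> bool \<times> nat \<times> entries" where
  "dec_msg = inv enc_msg"

lemma dec_enc_msg [simp]: "dec_msg (enc_msg m) = m"
  by (simp add: dec_msg_def inj_enc_msg)

text \<open>A label holds the side, the colour, and for each port the flow and the entries to be sent.\<close>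

type_synonym label = "bool \<times> nat \<times> int list \<times> entries list"

text \<open>Labels may have any length, so an injection into the numbers suffices here; only the
  message code has to be economical.\<close>

definition enc_label :: "label \<Rightarrow> bits" where
  "enc_label x = enc_nats [to_nat x]"

text \<open>Being an inverse function, decoding is total: every bit string an adversary chooses is
  read as some label.\<close>

definition dec_label :: "bits \<Rightarrow> label" where
  "dec_label = inv enc_label"

lemma dec_enc_label [simp]: "dec_label (enc_label x) = x"
  unfolding dec_label_def
  by (intro inv_f_f injI) (auto simp: enc_label_def dest!: inj_enc_nats simp del: enc_nats.simps)


section \<open>The verifier\<close>

text \<open>Side and colour are the same on all ports, so the number of distinct entry lists is the
  number of distinct messages.\<close>

definition at_most_msgs :: "nat \<Rightarrow> state \<Rightarrow> entries list \<Rightarrow> bool" where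
  "at_most_msgs r st es \<longleftrightarrow> card ((!) es ` {..<length (port_caps st)}) \<le> r"

text \<open>A label that prescribes too many messages silences its node. Thus the multicast
  restriction holds for every label, and \<open>flow_decide\<close> rejects such a label.\<close>

definition flow_msg :: "nat \<Rightarrow> state \<Rightarrow> bits \<Rightarrow> nat \<Rightarrow> bits" where
  "flow_msg r st l i = (case dec_label l of (b, c, F, es) \<Rightarrow>
     if at_most_msgs r st es then enc_msg (b, c, es ! i) else [])"

text \<open>A receiver looks up its own colour \<open>c\<close> in the entries \<open>es\<close> that it gets, and the sender checks
  that its own entries \<open>sent\<close>, looked up with the receiver's colour \<open>c'\<close>, are read as intended. So
  no separate check is needed that the colouring separates the neighbors of a node. If neither end
  announces a value, the flow has to be 0.\<close>

fun port_ok :: "bool \<Rightarrow> nat \<Rightarrow> int \<Rightarrow> entries \<Rightarrow> nat \<Rightarrow> bool \<times> nat \<times> entries \<Rightarrow> bool" where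
  "port_ok b c x sent w (b', c', es) \<longleftrightarrow>
     \<bar>x\<bar> \<le> int w \<and> (b \<and> \<not> b' \<longrightarrow> x = int w)
   \<and> map_of sent c' \<in> {None, Some x} \<and> map_of es c \<in> {None, Some (- x)}
   \<and> (map_of sent c' = None \<and> map_of es c = None \<longrightarrow> x = 0)"

declare port_ok.simps [simp del]

text \<open>The sink checks only its side of the cut; its balance follows from those of the other
  nodes by antisymmetry.\<close>

definition flow_decide :: "nat \<Rightarrow> nat \<Rightarrow> state \<Rightarrow> bits \<Rightarrow> bits list \<Rightarrow> bool" where
  "flow_decide k r st l ms = (case dec_label l of (b, c, F, es) \<Rightarrow>
     at_most_msgs r st es
   \<and> (case role st of
        Source \<Rightarrow> b \<and> (\<Sum>i<length (port_caps st). F ! i) = int k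
      | Sink \<Rightarrow> \<not> b
      | Inner \<Rightarrow> (\<Sum>i<length (port_caps st). F ! i) = 0)
   \<and> (\<forall>i<length (port_caps st).
        port_ok b c (F ! i) (es ! i) (port_caps st ! i) (dec_msg (ms ! i))))"

definition flow_verifier :: "nat \<Rightarrow> nat \<Rightarrow> verifier" where
  "flow_verifier k r = \<lparr> msg = flow_msg r, decide = flow_decide k r \<rparr>"

text \<open>A group consists of the ports with the same entry list, numbered by \<open>h\<close>;
  the message of a group is recovered by inverting \<open>h\<close>.\<close>

lemma MCAST_flow_verifier:
  assumes "1 \<le> r"
  shows "MCAST r (flow_verifier k r)"
  unfolding MCAST_def
proof (intro allI)
  fix st :: state and l
  define n where "n = length (port_caps st)"
  obtain b c F es where l: "dec_label l = (b, c, F, es)" by (metis prod_cases4)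
  show "\<exists>(g :: nat \<Rightarrow> nat) m. \<forall>i<length (port_caps st).
    g i < r \<and> msg (flow_verifier k r) st l i = m (g i)"
  proof (cases "at_most_msgs r st es")
    case True
    obtain h where h: "bij_betw h ((!) es ` {..<n}) {0..<card ((!) es ` {..<n})}"
      using ex_bij_betw_finite_nat[of "(!) es ` {..<n}"] by auto
    have "h (es ! i) < r" if "i < n" for i
    proof -
      have "h (es ! i) < card ((!) es ` {..<n})" using bij_betwE[OF h] that by auto
      then show ?thesis using True by (simp add: at_most_msgs_def n_def)
    qed
    moreover have "inv_into ((!) es ` {..<n}) h (h (es ! i)) = es ! i" if "i < n" for i
      using h that by (intro inv_into_f_f) (auto simp: bij_betw_def)
    ultimately show ?thesis using True l
      by (intro exI[of _ "\<lambda>i. h (es ! i)"]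
          exI[of _ "\<lambda>j. enc_msg (b, c, inv_into ((!) es ` {..<n}) h j)"])
        (simp add: flow_verifier_def flow_msg_def n_def)
  next
    case False
    then show ?thesis using assms l
      by (intro exI[of _ "\<lambda>i. 0"] exI[of _ "\<lambda>j. []"])
        (simp add: flow_verifier_def flow_msg_def)
  qed
qed

section \<open>From ports to neighbors, and soundness\<close>

lemma port_to_nth:
  assumes "G \<in> F_st" "v \<in> verts G" "i < length (ports G v)"
  shows "port_to G v (ports G v ! i) = i"
  unfolding port_to_def using assms
  by (intro the_equality) (auto simp: F_st_def nth_eq_iff_index_eq)

lemma port_to_nbr:
  assumes "G \<in> F_st" "v \<in> verts G" "u \<in> nbrs G v"
  shows "port_to G v u < length (ports G v)" "ports G v ! port_to G v u = u"
proof -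
  have "u \<in> set (ports G v)" using assms by (auto simp: F_st_def)
  then obtain i where "i < length (ports G v)" "ports G v ! i = u" by (auto simp: in_set_conv_nth)
  then show "port_to G v u < length (ports G v)" "ports G v ! port_to G v u = u"
    using port_to_nth[OF assms(1,2)] by auto
qed

lemma bij_betw_ports:
  assumes "G \<in> F_st" "v \<in> verts G"
  shows "bij_betw ((!) (ports G v)) {..<length (ports G v)} (nbrs G v)"
  using assms by (auto simp: F_st_def intro!: bij_betw_nth)

lemma image_ports:
  assumes "G \<in> F_st" "v \<in> verts G"
  shows "(\<lambda>i. g (ports G v ! i)) ` {..<length (ports G v)} = g ` nbrs G v"
  using bij_betw_imp_surj_on[OF bij_betw_ports[OF assms]] by (simp add: image_image[symmetric])

lemma sum_ports:
  assumes "G \<in> F_st" "v \<in> verts G"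
  shows "(\<Sum>i<length (ports G v). g (ports G v ! i)) = (\<Sum>u\<in>nbrs G v. g u)"
  by (rule sum.reindex_bij_betw[OF bij_betw_ports[OF assms]])

lemma ball_ports:
  assumes "G \<in> F_st" "v \<in> verts G"
  shows "(\<forall>i<length (ports G v). Q (ports G v ! i)) \<longleftrightarrow> (\<forall>u\<in>nbrs G v. Q u)"
  using bij_betw_imp_surj_on[OF bij_betw_ports[OF assms], symmetric] by auto

lemma length_port_caps [simp]: "length (port_caps (state_of G v)) = length (ports G v)"
  by (simp add: state_of_def)

text \<open>The decision with ports replaced by neighbors, shared by soundness and completeness. The
  bound \<open>few\<close> concerns all nodes because it makes the messages of the neighbors proper
  codes.\<close>

lemma decide_iff:
  assumes G: "G \<in> F_st" and v: "v \<in> verts G"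
    and l: "\<And>v. v \<in> verts G \<Longrightarrow> dec_label (l v) = (b v, c v, F v, es v)"
    and few: "\<And>v. v \<in> verts G \<Longrightarrow> at_most_msgs r (state_of G v) (es v)"
  shows "decide (flow_verifier k r) (state_of G v) (l v) (received (flow_verifier k r) G l v) \<longleftrightarrow>
      (case role (state_of G v) of
        Source \<Rightarrow> b v \<and> (\<Sum>u\<in>nbrs G v. F v ! port_to G v u) = int k
      | Sink \<Rightarrow> \<not> b v
      | Inner \<Rightarrow> (\<Sum>u\<in>nbrs G v. F v ! port_to G v u) = 0)
    \<and> (\<forall>u\<in>nbrs G v. port_ok (b v) (c v) (F v ! port_to G v u) (es v ! port_to G v u)
        (cap G {v, u}) (b u, c u, es u ! port_to G u v))"
proof -
  let ?n = "length (ports G v)"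
  have sum: "(\<Sum>i<?n. F v ! i) = (\<Sum>u\<in>nbrs G v. F v ! port_to G v u)"
    using sum_ports[OF G v, of "\<lambda>u. F v ! port_to G v u"] port_to_nth[OF G v] by simp
  have rec: "dec_msg (received (flow_verifier k r) G l v ! i)
      = (let u = ports G v ! i in (b u, c u, es u ! port_to G u v))"
    if "i < ?n" for i
  proof -
    have "ports G v ! i \<in> verts G"
      using that G v nbrs_subset_verts[OF G, of v] nth_mem[OF that] by (auto simp: F_st_def)
    then show ?thesis
      using that l few by (simp add: received_def flow_verifier_def flow_msg_def Let_def)
  qed
  have caps: "port_caps (state_of G v) ! i = cap G {v, ports G v ! i}" if "i < ?n" for i
    using that by (simp add: state_of_def)
  have "(\<forall>i<?n. port_ok (b v) (c v) (F v ! i) (es v ! i) (port_caps (state_of G v) ! i)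
        (dec_msg (received (flow_verifier k r) G l v ! i)))
      \<longleftrightarrow> (\<forall>i<?n. let u = ports G v ! i in
        port_ok (b v) (c v) (F v ! port_to G v u) (es v ! port_to G v u)
          (cap G {v, u}) (b u, c u, es u ! port_to G u v))"
    using rec caps port_to_nth[OF G v] by (simp add: Let_def)
  also have "\<dots> \<longleftrightarrow> (\<forall>u\<in>nbrs G v.
      port_ok (b v) (c v) (F v ! port_to G v u) (es v ! port_to G v u)
        (cap G {v, u}) (b u, c u, es u ! port_to G u v))"
    unfolding Let_def by (rule ball_ports[OF G v])
  finally show ?thesis
    using l[OF v] few[OF v] sum
    by (cases "role (state_of G v)") (simp_all add: flow_verifier_def flow_decide_def)
qed

text \<open>Every flow is bounded by the capacity of the cut, which the claimed flow saturates.\<close>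

lemma MF_if_accepted:
  assumes G: "G \<in> F_st" and acc: "accepted (flow_verifier k r) G l"
  shows "MF k G"
proof -
  define b where "b v = fst (dec_label (l v))" for v
  define c where "c v = fst (snd (dec_label (l v)))" for v
  define F where "F v = fst (snd (snd (dec_label (l v))))" for v
  define es where "es v = snd (snd (snd (dec_label (l v))))" for v
  define f where "f v u = F v ! port_to G v u" for v u
  have l: "dec_label (l v) = (b v, c v, F v, es v)" for v
    by (simp add: b_def c_def F_def es_def)
  have few: "at_most_msgs r (state_of G v) (es v)" if "v \<in> verts G" for v
    using acc that l[of v] by (auto simp: accepted_def flow_verifier_def flow_decide_def)
  have dec: "(case role (state_of G v) of
        Source \<Rightarrow> b v \<and> (\<Sum>u\<in>nbrs G v. f v u) = int k
      | Sink \<Rightarrow> \<not> b v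
      | Inner \<Rightarrow> (\<Sum>u\<in>nbrs G v. f v u) = 0)"
    and ok: "\<And>u. u \<in> nbrs G v \<Longrightarrow> port_ok (b v) (c v) (f v u) (es v ! port_to G v u)
        (cap G {v, u}) (b u, c u, es u ! port_to G u v)"
    if "v \<in> verts G" for v
    using acc that decide_iff[OF G that l few, of k] unfolding accepted_def f_def by blast+
  have ok: "port_ok (b v) (c v) (f v u) (es v ! port_to G v u)
        (cap G {v, u}) (b u, c u, es u ! port_to G u v)" if "{v, u} \<in> edges G" for v u
    using ok[of v u] that F_st_edgeD[OF G that] by (simp add: nbrs_def)
  have s: "src G \<in> verts G" "b (src G)" "(\<Sum>u\<in>nbrs G (src G). f (src G) u) = int k"
    and t: "snk G \<in> verts G" "\<not> b (snk G)"
    using dec[of "src G"] dec[of "snk G"] G by (auto simp: F_st_def state_of_def)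
  \<comment> \<open>Both ends evaluate the same two lookups. A lookup that succeeds equals the value
    of its sender and the negated value of its receiver; if both fail, both values are 0.\<close>
  have skew: "f v u = - f u v" if e: "{v, u} \<in> edges G" for v u
  proof -
    have e': "{u, v} \<in> edges G" using e by (simp add: insert_commute)
    show ?thesis using ok[OF e] ok[OF e'] by (auto simp: port_ok.simps)
  qed
  have capb: "\<bar>f v u\<bar> \<le> int (cap G {v, u})"
    and sat: "b v \<Longrightarrow> \<not> b u \<Longrightarrow> f v u = int (cap G {v, u})" if "{v, u} \<in> edges G" for v u
    using ok[OF that] by (auto simp: port_ok.simps)
  have flow: "is_flow G f"
    unfolding is_flow_def
  proof (intro conjI allI ballI impI)
    fix v assume "v \<in> verts G - {src G, snk G}"
    then show "(\<Sum>u\<in>nbrs G v. f v u) = 0" using dec[of v] by (simp add: state_of_def)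
  qed (use skew capb in blast)+
  have val: "flow_value G f = int k" using s(3) by (simp add: flow_value_def)
  define X where "X = {v \<in> verts G. b v}"
  have X: "X \<subseteq> verts G" "src G \<in> X" "snk G \<notin> X" using s t by (auto simp: X_def)
  have "flow_value G h \<le> int k" if h: "is_flow G h" for h
  proof -
    let ?t = "\<lambda>g v u. if {v, u} \<in> edges G then g v u else (0 :: int)"
    have cut: "(\<Sum>v\<in>X. \<Sum>u\<in>verts G - X. ?t g v u) = flow_value G g" if "is_flow G g" for g
      using st_flow_cut[OF G is_flow_st_flow[OF G that] X(1)] X by simp
    have "?t h v u \<le> ?t f v u" if "v \<in> X" "u \<in> verts G - X" for v u
    proof (cases "{v, u} \<in> edges G")
      case True
      then have "\<bar>h v u\<bar> \<le> int (cap G {v, u})" using h unfolding is_flow_def by blast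
      then show ?thesis using sat[OF True] that True by (simp add: X_def)
    qed simp
    then have "(\<Sum>v\<in>X. \<Sum>u\<in>verts G - X. ?t h v u) \<le> (\<Sum>v\<in>X. \<Sum>u\<in>verts G - X. ?t f v u)"
      by (intro sum_mono) blast
    then show ?thesis using cut[OF h] cut[OF flow] val by simp
  qed
  then show ?thesis unfolding MF_def using flow val by blast
qed

section \<open>Honest labels\<close>

text \<open>The side costs at most 3 bits. A value is encoded as a number of at most
  \<open>2 * k\<close>, hence by at most \<open>5 * (1 + lg k)\<close> bits, which is at most
  \<open>10 * lg k\<close>. The sender's colour is kept exact, since colour 0 takes a single
  bit.\<close>

lemma length_enc_msg_le:
  assumes "\<And>c' x. (c', x) \<in> set es \<Longrightarrow> c' \<le> M \<and> \<bar>x\<bar> \<le> int k"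
  shows "real (length (enc_msg (b, c, es)))
    \<le> 3 + real (length (nat_bits c)) + real (length es) * (5 * lg M + 10 * lg k)"
proof -
  have b: "length (nat_bits (of_bool b)) \<le> 3"
    by (cases b) (simp_all add: nat_bits.simps[of "Suc 0"])
  have x: "real (length (nat_bits (int_encode x))) \<le> 10 * lg k" if "\<bar>x\<bar> \<le> int k" for x
  proof -
    have "int_encode x \<le> 2 * k" using that by (auto simp: int_encode_def sum_encode_def)
    then have "lg (int_encode x) \<le> lg 2 + lg k" using lg_mono lg_mult order_trans by blast
    moreover have "lg 2 = 1" by (simp add: lg_def)
    ultimately show ?thesis
      using length_nat_bits_le[of "int_encode x"] lg_ge_1[of k] by linarith
  qed
  have "real (length (enc_nats (flatten_entries es)))
      \<le> real (length es) * (5 * lg M + 10 * lg k)"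
    using assms
  proof (induction es rule: flatten_entries.induct)
    case (2 c x es)
    have "real (length (nat_bits c)) \<le> 5 * lg M"
      using length_nat_bits_le[of c] lg_mono[of c M] "2.prems"[of c x] by simp
    moreover have "real (length (nat_bits (int_encode x))) \<le> 10 * lg k"
      using x "2.prems"[of c x] by simp
    moreover have "real (length (enc_nats (flatten_entries es)))
        \<le> real (length es) * (5 * lg M + 10 * lg k)"
      by (rule "2.IH") (use "2.prems" in \<open>meson list.set_intros(2)\<close>)
    ultimately show ?case by (simp add: algebra_simps)
  qed simp
  then show ?thesis using b by (simp add: enc_msg.simps)
qed

text \<open>Members of one residue class have distinct quotients, all at most
  \<open>m div r\<close>. For \<open>r = 0\<close> the remainder of \<open>j\<close> is
  \<open>j\<close> itself, leaving at most one member.\<close>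

lemma card_residue_le: "card {j. j < m \<and> j mod r = g} \<le> m div r + 1"
proof (cases "r = 0")
  case True
  then have "{j. j < m \<and> j mod r = g} \<subseteq> {g}" by auto
  then have "card {j. j < m \<and> j mod r = g} \<le> card {g}" by (intro card_mono) auto
  then show ?thesis by simp
next
  case False
  have "card {j. j < m \<and> j mod r = g} = card ((\<lambda>j. j div r) ` {j. j < m \<and> j mod r = g})"
    by (intro card_image[symmetric] inj_onI) (metis (mono_tags, lifting) mem_Collect_eq div_mult_mod_eq)
  also have "\<dots> \<le> card {..m div r}"
    by (intro card_mono) (auto intro: div_le_mono)
  finally show ?thesis by simp
qed

text \<open>The nodes of \<open>W\<close> are dealt round-robin into \<open>r\<close> groups, and a
  group shares the list of its members' values. As colours are distinct on \<open>N\<close>, a node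
  can only find its own value there.\<close>

lemma grouped_entries:
  fixes col :: "nat \<Rightarrow> nat" and f :: "nat \<Rightarrow> int"
  assumes N: "inj_on col N" and own: "W \<subseteq> N" "finite W" "card W \<le> m" and r: "1 \<le> r"
  obtains es :: "nat \<Rightarrow> entries" where "card (es ` N) \<le> r"
    "\<And>u. u \<in> N \<Longrightarrow> map_of (es u) (col u) \<in> {None, Some (f u)}"
    "\<And>u. u \<in> W \<Longrightarrow> map_of (es u) (col u) = Some (f u)"
    "\<And>u. length (es u) \<le> m div r + 1"
    "\<And>u. set (es u) \<subseteq> (\<lambda>u. (col u, f u)) ` W"
proof -
  obtain idx where idx: "bij_betw idx W {0..<card W}"
    using ex_bij_betw_finite_nat[OF own(2)] by blast
  \<comment> \<open>Nodes outside \<open>W\<close> join group 0, where no entry bears their colour;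
    so they take up no additional group.\<close>
  define grp where "grp u = (if u \<in> W then idx u mod r else 0)" for u
  define mem where "mem j = {w \<in> W. idx w mod r = j}" for j
  define lst where "lst j = map (\<lambda>u. (col u, f u)) (sorted_list_of_set (mem j))" for j
  have fin: "finite (mem j)" for j using own by (simp add: mem_def)
  have set: "set (lst j) = (\<lambda>u. (col u, f u)) ` mem j" for j
    using fin by (simp add: lst_def)
  have dist: "distinct (map fst (lst j))" for j
    using fin N own(1)
    by (auto simp: lst_def distinct_map comp_def mem_def intro: inj_on_subset)
  have len: "length (lst j) \<le> m div r + 1" for j
  proof -
    have "card (mem j) = card (idx ` mem j)"
      using idx by (intro card_image[symmetric]) (auto simp: bij_betw_def mem_def intro: inj_on_subset)
    also have "\<dots> \<le> card {i. i < m \<and> i mod r = j}"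
      using bij_betwE[OF idx] own(3) by (intro card_mono) (force simp: mem_def)+
    also have "\<dots> \<le> m div r + 1" by (rule card_residue_le)
    finally show ?thesis by (simp add: lst_def)
  qed
  have some: "map_of (lst j) (col u) = Some (f u)" if "u \<in> mem j" for u j
    using that set dist by (intro map_of_is_SomeI) auto
  have opt: "map_of (lst j) (col u) \<in> {None, Some (f u)}" if u: "u \<in> N" for u j
  proof (cases "map_of (lst j) (col u)")
    case (Some y)
    then have "(col u, y) \<in> set (lst j)" by (rule map_of_SomeD)
    then obtain w where "w \<in> mem j" "col u = col w" "y = f w" unfolding set by auto
    moreover from this have "u = w"
      using N u own(1) by (auto simp: mem_def dest: inj_onD)
    ultimately show ?thesis using Some by simp
  qed simp
  show thesis
  proof (rule that[of "\<lambda>u. lst (grp u)"])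
    have "(\<lambda>u. lst (grp u)) ` N \<subseteq> lst ` {..<r}" using r by (auto simp: grp_def)
    then have "card ((\<lambda>u. lst (grp u)) ` N) \<le> card (lst ` {..<r})" by (intro card_mono) auto
    also have "\<dots> \<le> r" using card_image_le[of "{..<r}" lst] by simp
    finally show "card ((\<lambda>u. lst (grp u)) ` N) \<le> r" .
    show "map_of (lst (grp u)) (col u) = Some (f u)" if "u \<in> W" for u
      using that by (intro some) (simp add: mem_def grp_def)
    show "set (lst (grp u)) \<subseteq> (\<lambda>u. (col u, f u)) ` W" for u
      unfolding set by (auto simp: mem_def)
  qed (use opt len in auto)
qed

text \<open>Greedy colouring of the graph that joins nodes with a common neighbor; its degrees are
  at most the square of the maximum degree.\<close>

lemma neighbour_colouring:
  assumes G: "G \<in> F_st"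
  obtains col :: "nat \<Rightarrow> nat" where "\<And>u. u \<in> verts G \<Longrightarrow> col u \<le> max_degree G * max_degree G"
    "\<And>v. inj_on col (nbrs G v)"
proof -
  let ?E = "\<lambda>u w. \<exists>v. u \<in> nbrs G v \<and> w \<in> nbrs G v"
  have fin: "finite (verts G)" using G by (simp add: F_st_def)
  have deg: "card (nbrs G v) \<le> max_degree G" if "v \<in> verts G" for v
    using fin that by (auto simp: max_degree_def)
  have sym: "u \<in> nbrs G v \<longleftrightarrow> v \<in> nbrs G u" for u v by (simp add: nbrs_def insert_commute)
  have few: "card {w \<in> verts G. w \<noteq> u \<and> ?E u w} \<le> max_degree G * max_degree G"
    if "u \<in> verts G" for u
  proof -
    have "card {w \<in> verts G. w \<noteq> u \<and> ?E u w} \<le> card (\<Union>v\<in>nbrs G u. nbrs G v)"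
      using finite_nbrs[OF G] sym by (intro card_mono) auto
    also have "\<dots> \<le> (\<Sum>v\<in>nbrs G u. card (nbrs G v))"
      by (rule card_UN_le[OF finite_nbrs[OF G]])
    also have "\<dots> \<le> card (nbrs G u) * max_degree G"
      using nbrs_subset_verts[OF G] deg by (intro sum_bounded_above[THEN order_trans]) auto
    also have "\<dots> \<le> max_degree G * max_degree G" using deg[OF that] by simp
    finally show ?thesis .
  qed
  have "\<exists>col :: nat \<Rightarrow> nat. \<forall>u\<in>verts G. col u \<le> max_degree G * max_degree G \<and>
      (\<forall>w\<in>verts G. w \<noteq> u \<longrightarrow> ?E u w \<longrightarrow> col u \<noteq> col w)"
    by (rule greedy_colouring[OF fin]) (blast, rule few)
  then obtain col :: "nat \<Rightarrow> nat"
    where col: "\<And>u. u \<in> verts G \<Longrightarrow> col u \<le> max_degree G * max_degree G"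
      "\<And>u w. u \<in> verts G \<Longrightarrow> w \<in> verts G \<Longrightarrow> w \<noteq> u \<Longrightarrow> ?E u w \<Longrightarrow> col u \<noteq> col w"
    by blast
  show thesis
  proof (rule that[of col])
    show "inj_on col (nbrs G v)" for v
      using col(2) nbrs_subset_verts[OF G, of v] by (intro inj_onI) blast
  qed (use col(1) in blast)
qed

text \<open>What completeness asks of the entry lists, stated for any \<open>col\<close> so that it
  covers both the constant colouring and the one that separates neighbors.\<close>

definition honest_entries ::
    "nat \<Rightarrow> config \<Rightarrow> (nat \<Rightarrow> nat \<Rightarrow> int) \<Rightarrow> (nat \<Rightarrow> nat) \<Rightarrow> (nat \<Rightarrow> nat \<Rightarrow> entries) \<Rightarrow> bool" where
  "honest_entries r G f col es \<longleftrightarrow>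
     (\<forall>v\<in>verts G. card (es v ` nbrs G v) \<le> r)
   \<and> (\<forall>v u. {v, u} \<in> edges G \<longrightarrow> map_of (es v u) (col u) \<in> {None, Some (f v u)}
        \<and> (map_of (es v u) (col u) = None \<longrightarrow> map_of (es u v) (col v) = None \<longrightarrow> f v u = 0))"

text \<open>The labels spell out the flow, the cut and the lists. The exact messages belong to the
  conclusion because the length bounds are read off from them.\<close>

lemma accepted_if_honest:
  assumes G: "G \<in> F_st" and f: "st_flow G f (int k)"
    and S: "src G \<in> S" "snk G \<notin> S"
      "\<And>v u. {v, u} \<in> edges G \<Longrightarrow> v \<in> S \<Longrightarrow> u \<notin> S \<Longrightarrow> f v u = int (cap G {v, u})"
    and es: "honest_entries r G f col es"
  obtains l where "accepted (flow_verifier k r) G l"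
    "\<And>v i. v \<in> verts G \<Longrightarrow> i < length (ports G v) \<Longrightarrow>
      msg (flow_verifier k r) (state_of G v) (l v) i = enc_msg (v \<in> S, col v, es v (ports G v ! i))"
proof -
  define l where "l v = enc_label (v \<in> S, col v, map (f v) (ports G v), map (es v) (ports G v))" for v
  have l: "dec_label (l v) = (v \<in> S, col v, map (f v) (ports G v), map (es v) (ports G v))" for v
    by (simp add: l_def)
  have few: "at_most_msgs r (state_of G v) (map (es v) (ports G v))" if "v \<in> verts G" for v
    using es that image_ports[OF G that, of "es v"]
    by (simp add: at_most_msgs_def honest_entries_def)
  have flow: "is_flow G f" "flow_value G f = int k" using st_flow_is_flow[OF G f] by auto
  have nth: "map g (ports G v) ! port_to G v u = g u" if "{v, u} \<in> edges G" for g :: "nat \<Rightarrow> 'b" and v u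
    using port_to_nbr[OF G, of v u] F_st_edgeD[OF G that] that by (simp add: nbrs_def)
  have sums: "(\<Sum>u\<in>nbrs G v. map (f v) (ports G v) ! port_to G v u) = (\<Sum>u\<in>nbrs G v. f v u)" for v
    by (intro sum.cong refl nth) (simp add: nbrs_def)
  have "accepted (flow_verifier k r) G l"
    unfolding accepted_def
  proof
    fix v assume v: "v \<in> verts G"
    have "port_ok (v \<in> S) (col v) (map (f v) (ports G v) ! port_to G v u)
        (map (es v) (ports G v) ! port_to G v u) (cap G {v, u})
        (u \<in> S, col u, map (es u) (ports G u) ! port_to G u v)" if "u \<in> nbrs G v" for u
    proof -
      have e: "{v, u} \<in> edges G" "{u, v} \<in> edges G"
        using that by (auto simp: nbrs_def insert_commute)
      have "\<bar>f v u\<bar> \<le> int (cap G {v, u})" "f u v = - f v u"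
        using st_flowD(1)[OF f, of u v] st_flowD(2)[OF f, of v u] e by auto
      moreover have "map_of (es v u) (col u) \<in> {None, Some (f v u)}"
        "map_of (es u v) (col v) \<in> {None, Some (f u v)}"
        "map_of (es v u) (col u) = None \<longrightarrow> map_of (es u v) (col v) = None \<longrightarrow> f v u = 0"
        using es e unfolding honest_entries_def by blast+
      ultimately show ?thesis using S(3)[OF e(1)] by (simp add: port_ok.simps nth e)
    qed
    moreover have "case role (state_of G v) of
        Source \<Rightarrow> v \<in> S \<and> (\<Sum>u\<in>nbrs G v. map (f v) (ports G v) ! port_to G v u) = int k
      | Sink \<Rightarrow> v \<notin> S
      | Inner \<Rightarrow> (\<Sum>u\<in>nbrs G v. map (f v) (ports G v) ! port_to G v u) = 0"
      using flow S(1,2) v unfolding sums by (simp add: state_of_def flow_value_def is_flow_def)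
    ultimately show "decide (flow_verifier k r) (state_of G v) (l v)
        (received (flow_verifier k r) G l v)"
      using decide_iff[OF G v l few] by blast
  qed
  moreover have "msg (flow_verifier k r) (state_of G v) (l v) i
      = enc_msg (v \<in> S, col v, es v (ports G v ! i))"
    if "v \<in> verts G" "i < length (ports G v)" for v i
    using few[OF that(1)] that(2) by (simp add: flow_verifier_def flow_msg_def l)
  ultimately show thesis using that by blast
qed

lemma honest_labels_exist:
  assumes G: "G \<in> F_st" and mf: "MF k G" and r: "1 \<le> r"
  defines "m \<equiv> min (arboricity G) k"
  shows "\<exists>l. accepted (flow_verifier k r) G l \<and>
    (\<forall>v\<in>verts G. \<forall>i<length (ports G v).
      real (length (msg (flow_verifier k r) (state_of G v) (l v) i))
      \<le> (if m < r then 19 * lg k else 33 * (real m / real r * (lg k + lg (max_degree G)))))"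
proof -
  obtain f own S where f: "st_flow G f (int k)"
    and S: "src G \<in> S" "snk G \<notin> S"
      "\<And>v u. {v, u} \<in> edges G \<Longrightarrow> v \<in> S \<Longrightarrow> u \<notin> S \<Longrightarrow> f v u = int (cap G {v, u})"
    and fk: "\<And>v u. \<bar>f v u\<bar> \<le> int k"
    and own: "\<And>v. v \<in> verts G \<Longrightarrow> finite (own v) \<and> card (own v) \<le> m"
    and cover: "\<And>v u. {v, u} \<in> edges G \<Longrightarrow> u \<in> own v \<or> v \<in> own u \<or> f v u = 0"
    unfolding m_def using flow_with_owners[OF G mf] by metis
  show ?thesis
  proof (cases "m < r")
    case True
    \<comment> \<open>Each list addresses only the neighbor it is sent to, so the constant colour 0
      serves as address.\<close>
    define es :: "nat \<Rightarrow> nat \<Rightarrow> entries"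
      where "es v u = (if u \<in> own v then [(0, f v u)] else [])" for v u
    have "card (es v ` nbrs G v) \<le> r" if v: "v \<in> verts G" for v
    proof -
      define B :: "entries set" where "B = (\<lambda>u. [(0, f v u)]) ` own v"
      have B: "finite B" "card B \<le> m"
        using own[OF v] card_image_le[of "own v" "\<lambda>u. [(0 :: nat, f v u)]"] by (auto simp: B_def)
      have "es v ` nbrs G v \<subseteq> insert [] B" by (auto simp: es_def B_def)
      then have "card (es v ` nbrs G v) \<le> card (insert [] B)" using B by (intro card_mono) auto
      \<comment> \<open>The empty list for the remaining neighbors costs one more group, hence the
        strict \<open>m < r\<close>.\<close>
      also have "\<dots> \<le> Suc (card B)" using B(1) by (simp add: card_insert_if)
      also have "\<dots> \<le> r" using B(2) True by simp
      finally show ?thesis .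
    qed
    then have "honest_entries r G f (\<lambda>v. 0) es"
      using cover by (auto simp: honest_entries_def es_def)
    then obtain l where l: "accepted (flow_verifier k r) G l"
      "\<And>v i. v \<in> verts G \<Longrightarrow> i < length (ports G v) \<Longrightarrow>
        msg (flow_verifier k r) (state_of G v) (l v) i = enc_msg (v \<in> S, 0, es v (ports G v ! i))"
      using accepted_if_honest[OF G f S] by metis
    have "real (length (enc_msg (b, 0, es v u))) \<le> 19 * lg k" for b v u
    proof -
      have "real (length (enc_msg (b, 0, es v u)))
          \<le> 3 + 1 + real (length (es v u)) * (5 * lg 0 + 10 * lg k)"
        using length_enc_msg_le[of "es v u" 0 k b 0] fk by (auto simp: es_def split: if_splits)
      also have "lg 0 = 1" by (simp add: lg_def log_def)
      \<comment> \<open>With at most one entry the length is at most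
        \<open>4 + 5 + 10 * lg k\<close>, and \<open>lg k\<close> is at least 1.\<close>
      finally show ?thesis using lg_ge_1[of k] by (auto simp: es_def split: if_splits)
    qed
    then show ?thesis using l True by auto
  next
    case False
    obtain col where col: "\<And>u. u \<in> verts G \<Longrightarrow> col u \<le> max_degree G * max_degree G"
      "\<And>v. inj_on col (nbrs G v)"
      using neighbour_colouring[OF G] by metis
    define good where "good v es \<longleftrightarrow> card (es ` nbrs G v) \<le> r
        \<and> (\<forall>u\<in>nbrs G v. map_of (es u) (col u) \<in> {None, Some (f v u)})
        \<and> (\<forall>u\<in>own v \<inter> nbrs G v. map_of (es u) (col u) = Some (f v u))
        \<and> (\<forall>u. length (es u) \<le> m div r + 1)
        \<and> (\<forall>u. set (es u) \<subseteq> (\<lambda>u. (col u, f v u)) ` nbrs G v)" for v and es :: "nat \<Rightarrow> entries"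
    have "\<exists>es. good v es" if v: "v \<in> verts G" for v
    proof -
      \<comment> \<open>The intersection removes owned nodes that are not neighbors, on which the
        colouring need not be injective.\<close>
      have W: "own v \<inter> nbrs G v \<subseteq> nbrs G v" "finite (own v \<inter> nbrs G v)"
        "card (own v \<inter> nbrs G v) \<le> m"
        using own[OF v] card_mono[of "own v" "own v \<inter> nbrs G v"] by auto
      show ?thesis
      proof (rule grouped_entries[where f = "f v", OF col(2) W r])
        fix es :: "nat \<Rightarrow> entries"
        assume "card (es ` nbrs G v) \<le> r"
          "\<And>u. u \<in> nbrs G v \<Longrightarrow> map_of (es u) (col u) \<in> {None, Some (f v u)}"
          "\<And>u. u \<in> own v \<inter> nbrs G v \<Longrightarrow> map_of (es u) (col u) = Some (f v u)"
          "\<And>u. length (es u) \<le> m div r + 1"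
          "\<And>u. set (es u) \<subseteq> (\<lambda>u. (col u, f v u)) ` (own v \<inter> nbrs G v)"
        then show ?thesis unfolding good_def by (intro exI[of _ es]) blast
      qed
    qed
    then have "\<forall>v\<in>verts G. \<exists>es. good v es" by blast
    then obtain es where "\<forall>v\<in>verts G. good v (es v)" by (auto dest: bchoice)
    then have es: "\<And>v. v \<in> verts G \<Longrightarrow> card (es v ` nbrs G v) \<le> r"
        "\<And>v u. v \<in> verts G \<Longrightarrow> u \<in> nbrs G v \<Longrightarrow> map_of (es v u) (col u) \<in> {None, Some (f v u)}"
        "\<And>v u. v \<in> verts G \<Longrightarrow> u \<in> own v \<inter> nbrs G v \<Longrightarrow> map_of (es v u) (col u) = Some (f v u)"
        "\<And>v u. v \<in> verts G \<Longrightarrow> length (es v u) \<le> m div r + 1"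
        "\<And>v u. v \<in> verts G \<Longrightarrow> set (es v u) \<subseteq> (\<lambda>u. (col u, f v u)) ` nbrs G v"
      unfolding good_def by blast+
    have "honest_entries r G f col es"
      unfolding honest_entries_def
    proof (intro conjI ballI allI impI)
      fix v u assume e: "{v, u} \<in> edges G"
      then have vu: "v \<in> verts G" "u \<in> verts G" "u \<in> nbrs G v" "v \<in> nbrs G u"
        using F_st_edgeD[OF G e] by (auto simp: nbrs_def insert_commute)
      show "map_of (es v u) (col u) \<in> {None, Some (f v u)}" using es(2) vu by blast
      assume "map_of (es v u) (col u) = None" "map_of (es u v) (col v) = None"
      then have "u \<notin> own v" "v \<notin> own u" using es(3)[of v u] es(3)[of u v] vu by auto
      then show "f v u = 0" using cover[OF e] by blast
    qed (use es(1) in blast)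
    then obtain l where l: "accepted (flow_verifier k r) G l"
      "\<And>v i. v \<in> verts G \<Longrightarrow> i < length (ports G v) \<Longrightarrow>
        msg (flow_verifier k r) (state_of G v) (l v) i = enc_msg (v \<in> S, col v, es v (ports G v ! i))"
      using accepted_if_honest[OF G f S] by metis
    define D where "D = max_degree G"
    have lgD: "lg (D * D) \<le> 2 * lg D" using lg_mult[of D D] by simp
    define q where "q = real m / real r"
    \<comment> \<open>This is where \<open>r <= m\<close> enters: \<open>m div r + 1\<close> is at
      most \<open>2 * q\<close>, and the cost of side and colour is absorbed into the
      product.\<close>
    have q: "1 \<le> q" using False r by (simp add: q_def)
    have "real (length (enc_msg (b, col v, es v u))) \<le> 33 * (q * (lg k + lg D))"
      if v: "v \<in> verts G" for b v u
    proof -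
      have "real (length (es v u)) \<le> real (m div r) + 1" using es(4)[OF v, of u] by linarith
      also have "\<dots> \<le> q + q" using q of_nat_div_le_of_nat[of m r, where ?'a = real] by (simp add: q_def)
      finally have len: "real (length (es v u)) \<le> 2 * q" by simp
      have "real (length (enc_msg (b, col v, es v u)))
          \<le> 3 + real (length (nat_bits (col v)))
            + real (length (es v u)) * (5 * lg (D * D) + 10 * lg k)"
      proof (rule length_enc_msg_le)
        fix c' x assume "(c', x) \<in> set (es v u)"
        then show "c' \<le> D * D \<and> \<bar>x\<bar> \<le> int k"
          using es(5)[OF v, of u] col(1) nbrs_subset_verts[OF G, of v] fk by (auto simp: D_def)
      qed
      also have "\<dots> \<le> 3 + 10 * lg D + 2 * q * (10 * lg D + 10 * lg k)"
      proof -
        have "real (length (nat_bits (col v))) \<le> 5 * lg (D * D)"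
          using length_nat_bits_le[of "col v"] lg_mono[OF col(1)[OF v]] by (simp add: D_def)
        moreover have "real (length (es v u)) * (5 * lg (D * D) + 10 * lg k)
            \<le> 2 * q * (10 * lg D + 10 * lg k)"
          using len lgD lg_ge_1[of k] lg_ge_1[of "D * D"] q by (intro mult_mono) auto
        ultimately show ?thesis using lgD by linarith
      qed
      \<comment> \<open>The 13 pays for side and colour, the 20 for the entries; together they give
        the constant 33.\<close>
      also have "\<dots> \<le> 13 * (q * (lg k + lg D)) + 20 * (q * (lg k + lg D))"
      proof -
        define Z where "Z = q * (lg k + lg D)"
        have "lg k + lg D \<le> Z"
          using mult_right_mono[OF q, of "lg k + lg D"] lg_ge_1[of k] lg_ge_1[of D]
          by (simp add: Z_def)
        then have "3 + 10 * lg D \<le> 13 * Z"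
          using lg_ge_1[of k] lg_ge_1[of D] by linarith
        then show ?thesis by (simp add: Z_def algebra_simps)
      qed
      finally show ?thesis by simp
    qed
    then show ?thesis using l False by (auto simp: q_def D_def)
  qed
qed

section \<open>Verification complexity and the final bounds\<close>

text \<open>Connectivity joins the source to the sink, hence gives it an edge. So the maximum in
  \<open>max_msg_length\<close> ranges over a nonempty set.\<close>

lemma ports_src_nonempty:
  assumes G: "G \<in> F_st"
  shows "ports G (src G) \<noteq> []"
proof -
  have s: "src G \<in> verts G" "snk G \<in> verts G" "src G \<noteq> snk G" using G by (auto simp: F_st_def)
  then have "(src G, snk G) \<in> {(x, y). {x, y} \<in> edges G}\<^sup>*"
    using G by (auto simp: F_st_def connected_graph_def)
  then obtain u where "{src G, u} \<in> edges G"
    using s(3) by (auto elim: converse_rtranclE)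
  then have "u \<in> set (ports G (src G))" using G s by (auto simp: F_st_def nbrs_def)
  then show ?thesis by auto
qed

lemma max_msg_length_le:
  assumes G: "G \<in> F_st" and le: "\<And>v i. v \<in> verts G \<Longrightarrow> i < length (ports G v) \<Longrightarrow>
    real (length (msg V (state_of G v) (P G v) i)) \<le> B"
  shows "real (max_msg_length P V G) \<le> B"
proof -
  let ?A = "{length (msg V (state_of G v) (P G v) i) | v i. v \<in> verts G \<and> i < length (ports G v)}"
  have "?A = (\<Union>v\<in>verts G. (\<lambda>i. length (msg V (state_of G v) (P G v) i)) ` {..<length (ports G v)})"
    by auto
  then have "finite ?A" using G by (auto simp: F_st_def)
  moreover have "length (msg V (state_of G (src G)) (P G (src G)) 0) \<in> ?A"
    using G ports_src_nonempty[OF G] by (auto simp: F_st_def)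
  then have "?A \<noteq> {}" by blast
  ultimately have "Max ?A \<in> ?A" by (rule Max_in)
  then show ?thesis using le unfolding max_msg_length_def by auto
qed

theorem theorem4:
  shows "\<exists>C::real. C > 0 \<and> (\<forall>k r :: nat. 1 \<le> k \<longrightarrow> 1 \<le> r \<longrightarrow>
    (\<exists>P V. is_PLS F_st (MF k) P V \<and> MCAST r V \<and>
       (\<forall>G\<in>F_st. MF k G \<longrightarrow> r < 2 * arboricity G \<longrightarrow>
          real (max_msg_length P V G)
            \<le> C * small_r_bound (arboricity G) (max_degree G) r k))
  \<and> (\<exists>P V. is_PLS F_st (MF k) P V \<and> MCAST r V \<and>
       (\<forall>G\<in>F_st. MF k G \<longrightarrow> 2 * arboricity G \<le> r \<longrightarrow> r \<le> max_degree G \<longrightarrow>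
          real (max_msg_length P V G) \<le> C * lg k)))"
proof (intro exI[of _ 33] conjI allI impI)
  fix k r :: nat assume r: "1 \<le> r"
  let ?V = "flow_verifier k r"
  let ?bound = "\<lambda>G. if min (arboricity G) k < r then 19 * lg k
    else 33 * (real (min (arboricity G) k) / real r * (lg k + lg (max_degree G)))"
  \<comment> \<open>One prover and one verifier serve both ranges of \<open>r\<close>; illegal
    configurations get arbitrary labels.\<close>
  have "\<forall>G. \<exists>l. G \<in> F_st \<longrightarrow> MF k G \<longrightarrow> accepted ?V G l \<and>
      (\<forall>v\<in>verts G. \<forall>i<length (ports G v).
        real (length (msg ?V (state_of G v) (l v) i)) \<le> ?bound G)"
    using honest_labels_exist[OF _ _ r] by metis
  then obtain P where P: "\<And>G. G \<in> F_st \<Longrightarrow> MF k G \<Longrightarrow> accepted ?V G (P G)"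
    "\<And>G v i. G \<in> F_st \<Longrightarrow> MF k G \<Longrightarrow> v \<in> verts G \<Longrightarrow> i < length (ports G v) \<Longrightarrow>
      real (length (msg ?V (state_of G v) (P G v) i)) \<le> ?bound G"
    by metis
  have len: "real (max_msg_length P ?V G) \<le> ?bound G" if "G \<in> F_st" "MF k G" for G
    using that P(2) by (intro max_msg_length_le) blast+
  have pls: "is_PLS F_st (MF k) P ?V"
    unfolding is_PLS_def using P(1) MF_if_accepted by blast
  note mcast = MCAST_flow_verifier[OF r, of k]
  have small: "real (max_msg_length P ?V G)
      \<le> 33 * small_r_bound (arboricity G) (max_degree G) r k" if "G \<in> F_st" "MF k G" for G
  proof -
    \<comment> \<open>The first branch of the bound is covered by the floor \<open>lg k\<close>, the
      second by the product.\<close>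
    have "?bound G \<le> 33 * small_r_bound (arboricity G) (max_degree G) r k"
      using lg_ge_1[of k] by (auto simp: small_r_bound_def max_def)
    then show ?thesis using len[OF that] by linarith
  qed
  have large: "real (max_msg_length P ?V G) \<le> 33 * lg k"
    if "G \<in> F_st" "MF k G" "2 * arboricity G \<le> r" for G
  proof -
    \<comment> \<open>Arboricity 0 is the case that uses \<open>1 <= r\<close>; otherwise the
      arboricity is less than its double.\<close>
    have "min (arboricity G) k < r" using that(3) r by linarith
    then show ?thesis using len[OF that(1,2)] lg_ge_1[of k] by simp
  qed
  show "\<exists>P V. is_PLS F_st (MF k) P V \<and> MCAST r V \<and>
       (\<forall>G\<in>F_st. MF k G \<longrightarrow> r < 2 * arboricity G \<longrightarrow>
          real (max_msg_length P V G)
            \<le> 33 * small_r_bound (arboricity G) (max_degree G) r k)"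
    using pls mcast small by blast
  show "\<exists>P V. is_PLS F_st (MF k) P V \<and> MCAST r V \<and>
       (\<forall>G\<in>F_st. MF k G \<longrightarrow> 2 * arboricity G \<le> r \<longrightarrow> r \<le> max_degree G \<longrightarrow>
          real (max_msg_length P V G) \<le> 33 * lg k)"
    using pls mcast large by blast
qed simp

end
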